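(* Let $k=O(1)$ be a constant. If there is a constant $c>1$ such that an $O(n^{-c})$-approximate Nash equilibrium of any $n$-player $k$-strategy anonymous game can be computed in polynomial time, then there is a fully polynomial-time approximation scheme (FPTAS) for computing (well-supported) Nash equilibria of $k$-strategy anonymous games; that is, there is an algorithm which, given an $n$-player $k$-strategy anonymous game and $\epsilon>0$, runs in time $\mathrm{poly}(n,1/\epsilon)$ and returns an $\epsilon$-well-supported Nash equilibrium of the game.
   Context: Anonymous game: a tuple $(n,k,\{u^i_a\}_{i\in[n],a\in[k]})$ with players $[n]=\{1,\dots,n\}$ and a common strategy set $[k]=\{1,\dots,k\}$. When player $i$ plays strategy $a$, her payoff is $u^i_a(x)$, where $u^i_a:\Pi^k_{n-1}\to[0,1]$ and $\Pi^k_{n-1}=\{(x_1,\dots,x_k): x_j\in\mathbb{Z}_{\ge 0},\ \sum_{j=1}^k x_j=n-1\}$; here $x_j$ is the number of the other $n-1$ players who play strategy $j$. The input to an algorithm is the list of all values $u^i_a(x)$. A mixed strategy is a probability distribution on $[k]$; a mixed strategy profile is $s=(s_1,\dots,s_n)$ with each $s_i$ a mixed strategy, and $s_{-i}$ denotes the strategies of the players other than $i$. Write $x\sim s_{-i}$ for the random partition in $\Pi^k_{n-1}$ obtained by independently drawing each player $j\ne i$'s strategy from $s_j$. The profile $s$ is an $\epsilon$-approximate Nash equilibrium iff for all $i\in[n]$ and all $a'\in[k]$, $$\mathbb{E}_{x\sim s_{-i}}[u^i_{a'}(x)]\le \mathbb{E}_{x\sim s_{-i},\,a\sim s_i}[u^i_a(x)]+\epsilon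 .$$ The profile $s$ is an $\epsilon$-well-supported Nash equilibrium iff for all $i\in[n]$ and all $a,a'\in[k]$, $$\mathbb{E}_{x\sim s_{-i}}[u^i_{a}(x)]>\mathbb{E}_{x\sim s_{-i}}[u^i_{a'}(x)]+\epsilon\ \Longrightarrow\ s_i(a')=0 .$$ (Every $\epsilon$-well-supported Nash equilibrium is an $\epsilon$-approximate Nash equilibrium.) Standing assumption: given a mixed strategy profile, players' expected payoffs can be computed exactly. *)

theory Defs
  imports "HOL-Probability.Probability" "HOL-Library.Landau_Symbols"
    "HOL-Computational_Algebra.Polynomial"
begin

section \<open>Anonymous games\<close>

text \<open>Players are \<open>{..<n}\<close> and strategies \<open>{..<k}\<close>; a partition \<open>(x\<^sub>1, \<dots>, x\<^sub>k)\<close> is a list of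
  length \<open>k\<close>. A game is given by \<open>u i a x\<close>, and only the values for \<open>i < n\<close>, \<open>a < k\<close> and
  \<open>x \<in> partitions (n - 1) k\<close> matter.\<close>

definition partitions :: "nat \<Rightarrow> nat \<Rightarrow> nat list set" where
  "partitions m k = {x. length x = k \<and> sum_list x = m}"

definition anonymous_game :: "nat \<Rightarrow> nat \<Rightarrow> (nat \<Rightarrow> nat \<Rightarrow> nat list \<Rightarrow> real) \<Rightarrow> bool" where
  "anonymous_game n k u \<longleftrightarrow> n \<ge> 1 \<and> k \<ge> 1 \<and>
     (\<forall>i<n. \<forall>a<k. \<forall>x\<in>partitions (n - 1) k. u i a x \<in> {0..1})"

definition mixed_profile :: "nat \<Rightarrow> nat \<Rightarrow> (nat \<Rightarrow> nat pmf) \<Rightarrow> bool" where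
  "mixed_profile n k s \<longleftrightarrow> (\<forall>i<n. set_pmf (s i) \<subseteq> {..<k})"

text \<open>The distribution of \<open>x \<sim> s\<^sub>-\<^sub>i\<close>. The second argument of \<^const>\<open>Pi_pmf\<close> is the
  irrelevant value of the drawn function outside its index set.\<close>

definition others_pmf :: "nat \<Rightarrow> nat \<Rightarrow> (nat \<Rightarrow> nat pmf) \<Rightarrow> nat \<Rightarrow> nat list pmf" where
  "others_pmf n k s i =
     map_pmf (\<lambda>f. map (\<lambda>a. card {j \<in> {..<n} - {i}. f j = a}) [0..<k])
       (Pi_pmf ({..<n} - {i}) 0 s)"

definition approx_NE ::
    "nat \<Rightarrow> nat \<Rightarrow> (nat \<Rightarrow> nat \<Rightarrow> nat list \<Rightarrow> real) \<Rightarrow> real \<Rightarrow> (nat \<Rightarrow> nat pmf) \<Rightarrow> bool" where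
  "approx_NE n k u \<epsilon> s \<longleftrightarrow> mixed_profile n k s \<and>
     (\<forall>i<n. \<forall>a'<k.
        measure_pmf.expectation (others_pmf n k s i) (u i a')
        \<le> measure_pmf.expectation (pair_pmf (others_pmf n k s i) (s i)) (\<lambda>(x, a). u i a x) + \<epsilon>)"

definition well_supported_NE ::
    "nat \<Rightarrow> nat \<Rightarrow> (nat \<Rightarrow> nat \<Rightarrow> nat list \<Rightarrow> real) \<Rightarrow> real \<Rightarrow> (nat \<Rightarrow> nat pmf) \<Rightarrow> bool" where
  "well_supported_NE n k u \<epsilon> s \<longleftrightarrow> mixed_profile n k s \<and>
     (\<forall>i<n. \<forall>a<k. \<forall>a'<k.
        measure_pmf.expectation (others_pmf n k s i) (u i a)
          > measure_pmf.expectation (others_pmf n k s i) (u i a') + \<epsilon>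
        \<longrightarrow> pmf (s i) a' = 0)"


section \<open>Model of computation\<close>

text \<open>Payoffs are arbitrary real numbers, running times are bounded in terms of \<open>n\<close> and \<open>1/\<epsilon>\<close>
  only, and expected payoffs are assumed to be computed exactly. The model is therefore a
  deterministic real RAM with exact real arithmetic at unit cost: structured programs
  over named multi-dimensional arrays of naturals and of reals (a scalar is an array with the
  empty index list).

  The instruction set is kept to the usual one in order not to make unit cost unreasonably
  powerful: on naturals (array indices) only addition and truncated subtraction, on reals
  only the field operations (with \<open>x / 0 = 0\<close>) and comparison, no rounding from reals to
  naturals, and only rational constants, so that no advice can be hidden in a program.\<close>

datatype iexp =
    IConst nat
  | IRef string "iexp list"
  | IAdd iexp iexp
  | ISub iexp iexp

datatype rexp =
    RConst rat
  | RRef string "iexp list"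
  | ROfNat iexp
  | RAdd rexp rexp
  | RSub rexp rexp
  | RMul rexp rexp
  | RDiv rexp rexp

datatype bexp =
    ILess iexp iexp
  | RLess rexp rexp
  | BNot bexp
  | BAnd bexp bexp

datatype prog =
    Skip
  | IAssign string "iexp list" iexp
  | RAssign string "iexp list" rexp
  | Seq prog prog
  | Cond bexp prog prog
  | Loop bexp prog

record state =
  ints :: "string \<Rightarrow> nat list \<Rightarrow> nat"
  reals :: "string \<Rightarrow> nat list \<Rightarrow> real"

fun ival :: "state \<Rightarrow> iexp \<Rightarrow> nat" where
  "ival \<sigma> (IConst m) = m"
| "ival \<sigma> (IRef v es) = ints \<sigma> v (map (ival \<sigma>) es)"
| "ival \<sigma> (IAdd e e') = ival \<sigma> e + ival \<sigma> e'"
| "ival \<sigma> (ISub e e') = ival \<sigma> e - ival \<sigma> e'"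

fun rval :: "state \<Rightarrow> rexp \<Rightarrow> real" where
  "rval \<sigma> (RConst q) = of_rat q"
| "rval \<sigma> (RRef v es) = reals \<sigma> v (map (ival \<sigma>) es)"
| "rval \<sigma> (ROfNat e) = real (ival \<sigma> e)"
| "rval \<sigma> (RAdd e e') = rval \<sigma> e + rval \<sigma> e'"
| "rval \<sigma> (RSub e e') = rval \<sigma> e - rval \<sigma> e'"
| "rval \<sigma> (RMul e e') = rval \<sigma> e * rval \<sigma> e'"
| "rval \<sigma> (RDiv e e') = rval \<sigma> e / rval \<sigma> e'"

fun bval :: "state \<Rightarrow> bexp \<Rightarrow> bool" where
  "bval \<sigma> (ILess e e') \<longleftrightarrow> ival \<sigma> e < ival \<sigma> e'"
| "bval \<sigma> (RLess e e') \<longleftrightarrow> rval \<sigma> e < rval \<sigma> e'"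
| "bval \<sigma> (BNot b) \<longleftrightarrow> \<not> bval \<sigma> b"
| "bval \<sigma> (BAnd b b') \<longleftrightarrow> bval \<sigma> b \<and> bval \<sigma> b'"

definition set_int :: "string \<Rightarrow> nat list \<Rightarrow> nat \<Rightarrow> state \<Rightarrow> state" where
  "set_int v is m \<sigma> = \<sigma>\<lparr>ints := (ints \<sigma>)(v := (ints \<sigma> v)(is := m))\<rparr>"

definition set_real :: "string \<Rightarrow> nat list \<Rightarrow> real \<Rightarrow> state \<Rightarrow> state" where
  "set_real v is r \<sigma> = \<sigma>\<lparr>reals := (reals \<sigma>)(v := (reals \<sigma> v)(is := r))\<rparr>"

text \<open>\<open>exec P \<sigma> t \<sigma>'\<close>: started in \<open>\<sigma>\<close>, the program \<open>P\<close> halts in \<open>\<sigma>'\<close> after \<open>t\<close> assignments,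
  skips and tests. Expressions are part of the fixed program, so each of these performs a number
  of elementary operations that does not depend on the input.\<close>

inductive exec :: "prog \<Rightarrow> state \<Rightarrow> nat \<Rightarrow> state \<Rightarrow> bool" where
  Skip: "exec Skip \<sigma> 1 \<sigma>"
| IAssign: "exec (IAssign v es e) \<sigma> 1 (set_int v (map (ival \<sigma>) es) (ival \<sigma> e) \<sigma>)"
| RAssign: "exec (RAssign v es e) \<sigma> 1 (set_real v (map (ival \<sigma>) es) (rval \<sigma> e) \<sigma>)"
| Seq: "exec P \<sigma> t \<sigma>' \<Longrightarrow> exec Q \<sigma>' t' \<sigma>'' \<Longrightarrow> exec (Seq P Q) \<sigma> (t + t') \<sigma>''"
| CondTrue: "bval \<sigma> b \<Longrightarrow> exec P \<sigma> t \<sigma>' \<Longrightarrow> exec (Cond b P Q) \<sigma> (1 + t) \<sigma>'"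
| CondFalse: "\<not> bval \<sigma> b \<Longrightarrow> exec Q \<sigma> t \<sigma>' \<Longrightarrow> exec (Cond b P Q) \<sigma> (1 + t) \<sigma>'"
| LoopFalse: "\<not> bval \<sigma> b \<Longrightarrow> exec (Loop b P) \<sigma> 1 \<sigma>"
| LoopTrue: "bval \<sigma> b \<Longrightarrow> exec P \<sigma> t \<sigma>' \<Longrightarrow> exec (Loop b P) \<sigma>' t' \<sigma>''
    \<Longrightarrow> exec (Loop b P) \<sigma> (1 + t + t') \<sigma>''"

lemma exec_deterministic:
  "exec P \<sigma> t \<sigma>' \<Longrightarrow> exec P \<sigma> t' \<sigma>'' \<Longrightarrow> t' = t \<and> \<sigma>'' = \<sigma>'"
proof (induction arbitrary: t' \<sigma>'' rule: exec.induct)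
  case (Seq P \<sigma> t \<sigma>1 Q t1 \<sigma>2)
  from Seq.prems show ?case
  proof cases
    case (Seq r \<rho> r')
    then show ?thesis using Seq.IH(1)[OF Seq(2)] Seq.IH(2)[of r' \<sigma>''] by simp
  qed
next
  case (CondTrue \<sigma> b P t \<sigma>1 Q)
  from CondTrue.prems CondTrue.hyps(1) CondTrue.IH show ?case by cases simp_all
next
  case (CondFalse \<sigma> b Q t \<sigma>1 P)
  from CondFalse.prems CondFalse.hyps(1) CondFalse.IH show ?case by cases simp_all
next
  case (LoopFalse \<sigma> b P)
  from LoopFalse.prems LoopFalse.hyps(1) show ?case by cases simp_all
next
  case (LoopTrue \<sigma> b P t \<sigma>1 t1 \<sigma>2)
  from LoopTrue.prems show ?case
  proof cases
    case LoopFalse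
    with LoopTrue.hyps(1) show ?thesis by simp
  next
    case (LoopTrue r \<rho> r')
    then show ?thesis using LoopTrue.IH(1)[OF LoopTrue(3)] LoopTrue.IH(2)[of r' \<sigma>''] by simp
  qed
qed (erule exec.cases; simp)+


section \<open>Algorithms for anonymous games\<close>

text \<open>Input: the natural number \<open>n\<close> and the table of all payoffs, with \<open>u i a (x\<^sub>1, \<dots>, x\<^sub>k)\<close> in
  the real cell \<open>u[i, a, x\<^sub>1, \<dots>, x\<^sub>k]\<close>; every other cell is zero. An approximation scheme gets
  \<open>\<epsilon>\<close> in the real variable \<open>eps\<close>. The number \<open>k\<close> is a constant that a program may depend on.\<close>

definition game_input :: "nat \<Rightarrow> nat \<Rightarrow> (nat \<Rightarrow> nat \<Rightarrow> nat list \<Rightarrow> real) \<Rightarrow> state" where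
  "game_input n k u =
     \<lparr>ints = (\<lambda>v is. if v = ''n'' \<and> is = [] then n else 0),
      reals = (\<lambda>v is. case is of
          i # a # x \<Rightarrow> if v = ''u'' \<and> i < n \<and> a < k \<and> x \<in> partitions (n - 1) k then u i a x else 0
        | _ \<Rightarrow> 0)\<rparr>"

text \<open>Output: the probability \<open>s\<^sub>i(a)\<close> in the real cell \<open>s[i, a]\<close>.\<close>

definition outputs_profile :: "nat \<Rightarrow> nat \<Rightarrow> state \<Rightarrow> (nat \<Rightarrow> nat pmf) \<Rightarrow> bool" where
  "outputs_profile n k \<sigma> s \<longleftrightarrow> (\<forall>i<n. \<forall>a<k. reals \<sigma> ''s'' [i, a] = pmf (s i) a)"

text \<open>For constant \<open>k\<close>, the number of payoffs in the input lies between \<open>n\<close> and \<open>k * n ^ k\<close>,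
  so polynomial time means polynomial in \<open>n\<close>.\<close>

definition approx_NE_in_poly_time :: "nat \<Rightarrow> (nat \<Rightarrow> real) \<Rightarrow> bool" where
  "approx_NE_in_poly_time k \<delta> \<longleftrightarrow>
     (\<exists>(P :: prog) (p :: nat poly). \<forall>n u. anonymous_game n k u \<longrightarrow>
        (\<exists>t \<sigma> s. exec P (game_input n k u) t \<sigma> \<and> t \<le> poly p n \<and>
           outputs_profile n k \<sigma> s \<and> approx_NE n k u (\<delta> n) s))"

text \<open>Here \<open>p\<close> is a polynomial in two variables, evaluated at \<open>n\<close> and \<open>1/\<epsilon>\<close>.\<close>

definition well_supported_NE_FPTAS :: "nat \<Rightarrow> bool" where
  "well_supported_NE_FPTAS k \<longleftrightarrow>
     (\<exists>(P :: prog) (p :: real poly poly). \<forall>n u \<epsilon>. anonymous_game n k u \<and> \<epsilon> > 0 \<longrightarrow>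
        (\<exists>t \<sigma> s. exec P (set_real ''eps'' [] \<epsilon> (game_input n k u)) t \<sigma> \<and>
           real t \<le> poly (poly p [:real n:]) (1 / \<epsilon>) \<and>
           outputs_profile n k \<sigma> s \<and> well_supported_NE n k u \<epsilon> s))"

end

theory Submission imports Defs begin

text \<open>An \<open>n\<close>-player game is padded with \<open>N - n\<close> dummy players who are paid 1 for strategy 0 and
  nothing otherwise, and whose presence the real players discount. In an \<open>\<eta>\<close>-approximate
  equilibrium every dummy plays 0 except with probability \<open>\<eta>\<close>, so all of them do except with
  probability \<open>N * \<eta> = O(N\<^sup>1\<^sup>-\<^sup>c)\<close>; since \<open>c > 1\<close>, this is as small as desired for some \<open>N\<close>
  polynomial in \<open>n\<close> and \<open>1/\<epsilon>\<close>.

  To make the result well supported, every probability below a cutoff \<open>\<tau>\<close> is moved to a strategy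
  of probability at least \<open>\<tau>\<close>. A strategy of probability at least \<open>\<tau>\<close> has regret at most
  \<open>\<eta> / \<tau>\<close>, and the move changes expected payoffs by at most \<open>n * k * \<tau>\<close>. The cutoff \<open>\<tau>\<close> of order
  \<open>\<epsilon> / (n * k)\<close> balances the two, and no expected payoff has to be computed.

  The given program is run unchanged on the table of the padded game: all data of the surrounding
  program live in an array whose name the given program does not mention.\<close>

section \<open>Expectations and product distributions\<close>

text \<open>The coupling inequality: on the support \<open>\<bar>F - G\<bar>\<close> is at most the
  indicator of \<open>B\<close>. Finite support makes all functions integrable.\<close>

lemma pmf_expectation_diff_le_prob:
  fixes F G :: "'a \<Rightarrow> real"
  assumes fin: "finite (set_pmf M)"
    and F: "\<And>x. x \<in> set_pmf M \<Longrightarrow> F x \<in> {0..1}" and G: "\<And>x. x \<in> set_pmf M \<Longrightarrow> G x \<in> {0..1}"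
    and eq: "\<And>x. x \<in> set_pmf M \<Longrightarrow> x \<notin> B \<Longrightarrow> F x = G x"
  shows "\<bar>measure_pmf.expectation M F - measure_pmf.expectation M G\<bar> \<le> measure_pmf.prob M B"
proof -
  have int: "integrable (measure_pmf M) h" for h :: "'a \<Rightarrow> real"
    using fin by (rule integrable_measure_pmf_finite)
  have "\<bar>measure_pmf.expectation M F - measure_pmf.expectation M G\<bar>
      = \<bar>measure_pmf.expectation M (\<lambda>x. F x - G x)\<bar>"
    by (simp add: int)
  also have "\<dots> \<le> measure_pmf.expectation M (\<lambda>x. \<bar>F x - G x\<bar>)"
    using integral_norm_bound[of M "\<lambda>x. F x - G x"] by simp
  also have "\<dots> \<le> measure_pmf.expectation M (indicator B)"
  proof (rule integral_mono_AE[OF int int])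
    show "AE x in measure_pmf M. \<bar>F x - G x\<bar> \<le> indicator B x"
      using F G eq by (fastforce simp: AE_measure_pmf_iff indicator_def abs_le_iff)
  qed
  finally show ?thesis by simp
qed

text \<open>The map \<open>h\<close> may depend on the coordinate, because each player's
  thresholding map depends on her own distribution.\<close>

lemma Pi_pmf_map_dependent:
  assumes "finite A"
  shows "Pi_pmf A d' (\<lambda>x. map_pmf (h x) (p x))
    = map_pmf (\<lambda>f x. if x \<in> A then h x (f x) else d') (Pi_pmf A d p)"
  using assms by (simp add: map_pmf_def Pi_pmf_bind[where d' = d])

lemma finite_set_Pi_pmf:
  assumes "finite A" "\<And>x. x \<in> A \<Longrightarrow> finite (set_pmf (p x))"
  shows "finite (set_pmf (Pi_pmf A d p))"
  using assms by (auto simp: set_Pi_pmf intro!: finite_PiE_dflt)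

lemma prob_Pi_pmf_component:
  assumes "finite A" "j \<in> A"
  shows "measure_pmf.prob (Pi_pmf A d p) {f. f j \<in> B} = measure_pmf.prob (p j) B"
proof -
  have "measure_pmf.prob (p j) B = measure_pmf.prob (map_pmf (\<lambda>f. f j) (Pi_pmf A d p)) B"
    using assms by (simp add: Pi_pmf_component)
  then show ?thesis by (simp add: vimage_def)
qed

text \<open>Union bound over the coordinates; each single event has its marginal
  probability.\<close>

lemma prob_Pi_pmf_UN:
  assumes "finite A"
  shows "measure_pmf.prob (Pi_pmf A d p) {f. \<exists>j\<in>A. f j \<in> B j} \<le> (\<Sum>j\<in>A. measure_pmf.prob (p j) (B j))"
proof -
  have "{f. \<exists>j\<in>A. f j \<in> B j} = (\<Union>j\<in>A. {f. f j \<in> B j})" by auto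
  then have "measure_pmf.prob (Pi_pmf A d p) {f. \<exists>j\<in>A. f j \<in> B j}
      \<le> (\<Sum>j\<in>A. measure_pmf.prob (Pi_pmf A d p) {f. f j \<in> B j})"
    using assms by (simp add: measure_pmf.finite_measure_subadditive_finite)
  also have "\<dots> = (\<Sum>j\<in>A. measure_pmf.prob (p j) (B j))"
    using assms by (intro sum.cong) (auto simp: prob_Pi_pmf_component)
  finally show ?thesis .
qed

section \<open>Padding with dummy players\<close>

text \<open>The deterministic part of \<open>others_pmf\<close>, split off so that partitions of
  both games can be read off the same draw \<open>f\<close>.\<close>

definition counts :: "nat \<Rightarrow> nat \<Rightarrow> nat \<Rightarrow> (nat \<Rightarrow> nat) \<Rightarrow> nat list" where
  "counts k n i f = map (\<lambda>a. card {j \<in> {..<n} - {i}. f j = a}) [0..<k]"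

lemma others_pmf_counts:
  "others_pmf n k s i = map_pmf (counts k n i) (Pi_pmf ({..<n} - {i}) 0 s)"
  by (simp add: others_pmf_def counts_def[abs_def])

lemma counts_in_partitions:
  assumes "i < n" "\<And>j. j < n \<Longrightarrow> j \<noteq> i \<Longrightarrow> f j < k"
  shows "counts k n i f \<in> partitions (n - 1) k"
proof -
  have "sum_list (counts k n i f) = (\<Sum>a<k. card {j \<in> {..<n} - {i}. f j = a})"
    by (simp add: counts_def sum_list_sum_nth atLeast0LessThan)
  also have "\<dots> = card (\<Union>a<k. {j \<in> {..<n} - {i}. f j = a})"
    by (rule card_UN_disjoint[symmetric]) auto
  also have "(\<Union>a<k. {j \<in> {..<n} - {i}. f j = a}) = {..<n} - {i}"
    using assms(2) by auto
  finally show ?thesis using assms(1) by (simp add: partitions_def counts_def)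
qed

lemma counts_cong:
  assumes "\<And>j. j < n \<Longrightarrow> j \<noteq> i \<Longrightarrow> f j = g j"
  shows "counts k n i f = counts k n i g"
proof -
  have "{j \<in> {..<n} - {i}. f j = a} = {j \<in> {..<n} - {i}. g j = a}" for a
    using assms by auto
  then show ?thesis by (simp add: counts_def)
qed

text \<open>Payoffs see counts only, so \<open>N - n\<close> plays of strategy 0 are attributed to
  the dummies. If there are fewer, some dummy has deviated and a real player gets the default value
  0. Deviations masked by real players choosing 0 go unnoticed; either way such draws are charged to
  the error probability.\<close>

definition padded_game ::
    "nat \<Rightarrow> nat \<Rightarrow> (nat \<Rightarrow> nat \<Rightarrow> nat list \<Rightarrow> real) \<Rightarrow> nat \<Rightarrow> nat \<Rightarrow> nat list \<Rightarrow> real" where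
  "padded_game n N u i a x =
     (if i < n then if N - n \<le> hd x then u i a ((hd x - (N - n)) # tl x) else 0
      else if a = 0 then 1 else 0)"

text \<open>Since \<open>i < n\<close>, all \<open>N - n\<close> dummies are among the opponents of
  \<open>i\<close>, and they contribute to the count of strategy 0 only, which is the head of the
  list.\<close>

lemma counts_pad:
  assumes "i < n" "n \<le> N" "k \<ge> 1" "\<And>j. n \<le> j \<Longrightarrow> j < N \<Longrightarrow> f j = 0"
  shows "N - n \<le> hd (counts k N i f)"
    and "(hd (counts k N i f) - (N - n)) # tl (counts k N i f) = counts k n i f"
proof -
  obtain k' where k: "k = Suc k'" using assms(3) by (cases k) auto
  have *: "[0..<k] = 0 # [1..<k]" using k by (simp add: upt_rec)
  have "{j \<in> {..<N} - {i}. f j = 0} = {j \<in> {..<n} - {i}. f j = 0} \<union> {n..<N}"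
    using assms by auto
  moreover have "card ({j \<in> {..<n} - {i}. f j = 0} \<union> {n..<N})
      = card {j \<in> {..<n} - {i}. f j = 0} + card {n..<N}"
    by (rule card_Un_disjoint) auto
  ultimately have z: "card {j \<in> {..<N} - {i}. f j = 0} = card {j \<in> {..<n} - {i}. f j = 0} + (N - n)"
    by simp
  have nz: "{j \<in> {..<N} - {i}. f j = a} = {j \<in> {..<n} - {i}. f j = a}" if "a \<ge> 1" for a
  proof -
    have "j < n" if "j < N" "f j = a" for j
      using assms(4)[of j] that \<open>a \<ge> 1\<close> by (cases "j < n") auto
    then show ?thesis using assms(2) by auto
  qed
  show "N - n \<le> hd (counts k N i f)" unfolding counts_def * list.map list.sel z by simp
  show "(hd (counts k N i f) - (N - n)) # tl (counts k N i f) = counts k n i f"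
    unfolding counts_def * list.map list.sel z using nz by simp
qed

text \<open>Subtracting \<open>N - n\<close> from the head of a partition of \<open>N - 1\<close>
  yields a partition of \<open>n - 1\<close>, where the payoffs of \<open>u\<close> are known to lie
  in the unit interval.\<close>

lemma anonymous_game_padded:
  assumes "anonymous_game n k u" "n \<le> N"
  shows "anonymous_game N k (padded_game n N u)"
proof -
  have "padded_game n N u i a x \<in> {0..1}" if "a < k" "x \<in> partitions (N - 1) k" for i a x
  proof (cases "i < n \<and> N - n \<le> hd x")
    case True
    from that(2) assms obtain y ys where x: "x = y # ys"
      by (cases x) (auto simp: partitions_def anonymous_game_def)
    have "(hd x - (N - n)) # tl x \<in> partitions (n - 1) k"
      using that(2) x True assms by (auto simp: partitions_def anonymous_game_def)
    then show ?thesis using True assms that by (auto simp: padded_game_def anonymous_game_def)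
  qed (auto simp: padded_game_def)
  then show ?thesis using assms by (auto simp: anonymous_game_def)
qed

text \<open>The thresholded profile is the image of the given one under a map, so both can be coupled
  on the same random draw. The draws differ in their effect on a real player only if a dummy
  deviates from 0 or a player draws a strategy of probability below \<open>\<tau>\<close>.\<close>

lemma well_supported_of_padded_approx_NE:
  fixes \<eta> \<tau> \<epsilon> :: real
  assumes game: "anonymous_game n k u" and nN: "n \<le> N"
    and NE: "approx_NE N k (padded_game n N u) \<eta> s"
    and \<tau>: "\<tau> > 0"
    and g: "\<And>i. i < n \<Longrightarrow> g i < k \<and> \<tau> \<le> pmf (s i) (g i)"
    and \<eta>0: "\<eta> \<ge> 0"
    and bound: "\<eta> / \<tau> + 2 * (real (N - n) * \<eta> + real n * (real k * \<tau>)) \<le> \<epsilon>"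
  shows "well_supported_NE n k u \<epsilon>
    (\<lambda>i. map_pmf (\<lambda>a. if pmf (s i) a < \<tau> then g i else a) (s i))"
    (is "well_supported_NE n k u \<epsilon> ?s")
proof -
  have k1: "k \<ge> 1" and n1: "n \<ge> 1" using game by (auto simp: anonymous_game_def)
  have mp: "set_pmf (s i) \<subseteq> {..<k}" if "i < N" for i
    using NE that by (auto simp: approx_NE_def mixed_profile_def)
  have fins: "finite (set_pmf (s i))" if "i < N" for i
    using mp[OF that] finite_subset by blast
  let ?M = "\<lambda>i. Pi_pmf ({..<N} - {i}) 0 s"
  let ?pu = "padded_game n N u"
  let ?h = "\<lambda>i a. if pmf (s i) a < \<tau> then g i else a"
  define V where "V i a = measure_pmf.expectation (others_pmf N k s i) (?pu i a)" for i a
  define W where "W i a = measure_pmf.expectation (others_pmf n k ?s i) (u i a)" for i a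
  have finM: "finite (set_pmf (?M i))" for i
    by (rule finite_set_Pi_pmf) (auto intro: fins)
  have Mlt: "f j < k" if "f \<in> set_pmf (?M i)" "j < N" "j \<noteq> i" for f i j
    using that mp[of j] by (auto simp: set_Pi_pmf PiE_dflt_def)
  have V: "V i a = measure_pmf.expectation (?M i) (\<lambda>f. ?pu i a (counts k N i f))" for i a
    by (simp add: V_def others_pmf_counts)
  have pgame: "anonymous_game N k ?pu" using game nN by (rule anonymous_game_padded)
  have regret: "V i a' \<le> (\<Sum>a<k. pmf (s i) a * V i a) + \<eta>" if "i < N" "a' < k" for i a'
  proof -
    let ?P = "others_pmf N k s i"
    have finP: "finite (set_pmf ?P)" using finM[of i] by (simp add: others_pmf_counts)
    have "V i a' \<le> measure_pmf.expectation (pair_pmf ?P (s i)) (\<lambda>(x, a). ?pu i a x) + \<eta>"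
      using NE that by (simp add: approx_NE_def V_def)
    \<comment> \<open>The two independent draws are swapped, so that the player's own strategy is
      drawn first and the expectation becomes a weighted sum of the \<open>V i a\<close>.\<close>
    also have "pair_pmf ?P (s i) = bind_pmf (s i) (\<lambda>a. map_pmf (\<lambda>x. (x, a)) ?P)"
      unfolding pair_pmf_def map_pmf_def by (rule bind_commute_pmf)
    also have "measure_pmf.expectation \<dots> (\<lambda>(x, a). ?pu i a x)
        = (\<Sum>a<k. pmf (s i) a *\<^sub>R measure_pmf.expectation (map_pmf (\<lambda>x. (x, a)) ?P) (\<lambda>(x, a). ?pu i a x))"
      by (rule pmf_expectation_bind) (use mp[OF that(1)] finP in auto)
    finally show ?thesis by (simp add: V_def)
  qed
  \<comment> \<open>A dummy's expected payoff is exactly her probability of strategy 0, while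
    playing 0 outright would give 1; her regret is thus the probability of deviating.\<close>
  have dummy: "measure_pmf.prob (s j) (- {0}) \<le> \<eta>" if "n \<le> j" "j < N" for j
  proof -
    have one: "V j a = (if a = 0 then 1 else 0)" for a
      using that by (simp add: V padded_game_def)
    have "1 \<le> (\<Sum>a<k. pmf (s j) a * V j a) + \<eta>"
      using regret[of j 0] that k1 one[of 0] by simp
    also have "(\<Sum>a<k. pmf (s j) a * V j a) = pmf (s j) 0"
      using k1 by (simp add: one if_distrib cong: if_cong)
    finally show ?thesis
      by (simp add: measure_pmf.prob_compl[of "{0}", simplified] Compl_eq_Diff_UNIV measure_pmf_single)
  qed
  \<comment> \<open>At most \<open>k\<close> strategies are light, each of probability below
    \<open>\<tau>\<close>.\<close>
  have small: "measure_pmf.prob (s j) {a. pmf (s j) a < \<tau>} \<le> k * \<tau>" if "j < N" for j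
  proof -
    have "measure_pmf.prob (s j) {a. pmf (s j) a < \<tau>}
        = measure_pmf.prob (s j) ({a. pmf (s j) a < \<tau>} \<inter> set_pmf (s j))"
      by (simp add: measure_Int_set_pmf)
    also have "\<dots> \<le> measure_pmf.prob (s j) {a. a < k \<and> pmf (s j) a < \<tau>}"
      using mp[OF that] by (intro measure_pmf.finite_measure_mono) auto
    also have "\<dots> = (\<Sum>a | a < k \<and> pmf (s j) a < \<tau>. pmf (s j) a)"
      by (simp add: measure_measure_pmf_finite)
    also have "\<dots> \<le> (\<Sum>a | a < k \<and> pmf (s j) a < \<tau>. \<tau>)"
      by (rule sum_mono) auto
    also have "\<dots> \<le> k * \<tau>"
      using \<tau> card_mono[of "{..<k}" "{a. a < k \<and> pmf (s j) a < \<tau>}"]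
      by (auto intro!: mult_right_mono)
    finally show ?thesis .
  qed
  \<comment> \<open>The bound on the failure probability of the coupling: \<open>\<eta>\<close> for
    each dummy and \<open>k * \<tau>\<close> for each real player.\<close>
  define \<beta> where "\<beta> = real (N - n) * \<eta> + real n * (real k * \<tau>)"
  have close: "\<bar>W i a - V i a\<bar> \<le> \<beta>" if i: "i < n" and a: "a < k" for i a
  proof -
    let ?A = "{..<n} - {i}"
    let ?H = "\<lambda>f j. if j \<in> ?A then ?h j (f j) else 0"
    let ?B = "\<lambda>j. if j < n then {a. pmf (s j) a < \<tau>} else - {0}"
    \<comment> \<open>By \<open>e2\<close> the draw of the real opponents is a marginal of the draw
      of all \<open>N - 1\<close> opponents; by \<open>e1\<close> thresholding acts on it
      coordinatewise.\<close>
    have e1: "Pi_pmf ?A 0 ?s = map_pmf ?H (Pi_pmf ?A 0 s)"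
      by (rule Pi_pmf_map_dependent) simp
    have e2: "Pi_pmf ?A 0 s = map_pmf (\<lambda>f j. if j \<in> ?A then f j else 0) (?M i)"
      using nN by (intro Pi_pmf_subset) auto
    have "Pi_pmf ?A 0 ?s = map_pmf ?H (map_pmf (\<lambda>f j. if j \<in> ?A then f j else 0) (?M i))" 
      unfolding e1 e2 ..
    then have W: "W i a = measure_pmf.expectation (?M i) (\<lambda>f. u i a (counts k n i (\<lambda>j. ?h j (f j))))"
      by (auto simp: W_def others_pmf_counts intro!: Bochner_Integration.integral_cong
          arg_cong[where f = "u i a"] counts_cong)
    have "\<bar>W i a - V i a\<bar> \<le> measure_pmf.prob (?M i) {f. \<exists>j\<in>{..<N} - {i}. f j \<in> ?B j}"
      unfolding W V
    proof (rule pmf_expectation_diff_le_prob)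
      fix f assume f: "f \<in> set_pmf (?M i)"
      have "counts k n i (\<lambda>j. ?h j (f j)) \<in> partitions (n - 1) k"
        using i nN g Mlt[OF f] by (intro counts_in_partitions) auto
      then show "u i a (counts k n i (\<lambda>j. ?h j (f j))) \<in> {0..1}"
        using game i a by (simp add: anonymous_game_def)
      have "counts k N i f \<in> partitions (N - 1) k"
        using i nN Mlt[OF f] by (intro counts_in_partitions) auto
      then show "?pu i a (counts k N i f) \<in> {0..1}"
        using pgame i nN a by (simp add: anonymous_game_def)
      assume "f \<notin> {f. \<exists>j\<in>{..<N} - {i}. f j \<in> ?B j}"
      then have nB: "f j \<notin> ?B j" if "j < N" "j \<noteq> i" for j using that by blast
      have good: "?h j (f j) = f j" if "j < n" "j \<noteq> i" for j
        using nB[of j] that nN by simp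
      have zero: "f j = 0" if "n \<le> j" "j < N" for j
        using nB[of j] that i by simp
      have "counts k n i (\<lambda>j. ?h j (f j)) = counts k n i f"
        using good by (rule counts_cong)
      then show "u i a (counts k n i (\<lambda>j. ?h j (f j))) = ?pu i a (counts k N i f)"
        using counts_pad[OF i nN k1, of f] zero i by (simp add: padded_game_def)
    qed (rule finM)
    also have "\<dots> \<le> (\<Sum>j\<in>{..<N} - {i}. measure_pmf.prob (s j) (?B j))"
      by (rule prob_Pi_pmf_UN) simp
    also have "\<dots> \<le> (\<Sum>j<N. measure_pmf.prob (s j) (?B j))"
      by (rule sum_mono2) auto
    also have "{..<N} = {..<n} \<union> {n..<N}" using nN by auto
    also have "(\<Sum>j\<in>{..<n} \<union> {n..<N}. measure_pmf.prob (s j) (?B j))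
        = (\<Sum>j<n. measure_pmf.prob (s j) (?B j)) + (\<Sum>j\<in>{n..<N}. measure_pmf.prob (s j) (?B j))"
      by (rule sum.union_disjoint) auto
    also have "\<dots> \<le> (\<Sum>j<n. k * \<tau>) + (\<Sum>j\<in>{n..<N}. \<eta>)"
      using nN by (intro add_mono sum_mono) (auto simp: small dummy)
    finally show ?thesis by (simp add: \<beta>_def ac_simps)
  qed
  have WS: "W i a \<le> W i a' + \<epsilon>" if "i < n" "a < k" "a' < k" "\<tau> \<le> pmf (s i) a'" for i a a'
  proof -
    have iN: "i < N" using that nN by simp
    have 1: "(\<Sum>a<k. pmf (s i) a) = 1"
      using mp[OF iN] by (simp add: sum_pmf_eq_1)
    obtain b where b: "b < k" "\<And>a. a < k \<Longrightarrow> V i a \<le> V i b"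
    proof -
      have "V i ` {..<k} \<noteq> {}" using k1 by (auto simp: lessThan_empty_iff)
      then have "Max (V i ` {..<k}) \<in> V i ` {..<k}" by (intro Max_in) auto
      then obtain b where "b < k" "V i b = Max (V i ` {..<k})" by auto
      then show ?thesis by (intro that[of b]) auto
    qed
    \<comment> \<open>As \<open>b\<close> is a best reply, all terms of the regret sum are
      nonnegative, so the single term of \<open>a'\<close> is at most \<open>\<eta>\<close>. Going
      from \<open>V\<close> to \<open>W\<close> then costs \<open>\<beta>\<close> once for
      \<open>a\<close> and once for \<open>a'\<close>, hence the factor 2 in
      \<open>bound\<close>.\<close>
    have "\<tau> * (V i b - V i a') \<le> pmf (s i) a' * (V i b - V i a')"
      using that b by (intro mult_right_mono) auto
    also have "\<dots> \<le> (\<Sum>a<k. pmf (s i) a * (V i b - V i a))"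
      using that b by (intro member_le_sum) auto
    also have "\<dots> = (\<Sum>a<k. pmf (s i) a) * V i b - (\<Sum>a<k. pmf (s i) a * V i a)"
      by (simp add: algebra_simps sum_subtractf sum_distrib_left)
    also have "\<dots> \<le> \<eta>" using regret[OF iN b(1)] 1 by simp
    finally have "V i b - V i a' \<le> \<eta> / \<tau>" using \<tau> by (simp add: field_simps)
    then show ?thesis using b(2)[OF that(2)] close[OF that(1,2)] close[OF that(1,3)] bound[folded \<beta>_def]
      by linarith
  qed
  \<comment> \<open>The thresholding map takes only heavy values: \<open>g i\<close>, or a strategy
    that it leaves in place.\<close>
  have supp: "\<tau> \<le> pmf (s i) a'" if "i < n" "pmf (?s i) a' \<noteq> 0" for i a'
  proof -
    from that(2) have "a' \<in> set_pmf (?s i)" by (simp only: set_pmf_iff not_False_eq_True)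
    then obtain b where "a' = ?h i b" by (auto simp only: set_map_pmf)
    then show ?thesis using g[OF that(1)] by (cases "pmf (s i) b < \<tau>") auto
  qed
  have mixed: "mixed_profile n k ?s"
  proof -
    have "?h i b < k" if "i < n" "b \<in> set_pmf (s i)" for i b
      using mp[of i] g that nN by auto
    then show ?thesis by (auto simp only: mixed_profile_def set_map_pmf lessThan_iff)
  qed
  show ?thesis
    unfolding well_supported_NE_def W_def[symmetric]
  proof (intro conjI allI impI)
    fix i a a' assume "i < n" "a < k" "a' < k" "W i a' + \<epsilon> < W i a"
    then show "pmf (?s i) a' = 0" using WS[of i a a'] supp[of i a'] by linarith
  qed (rule mixed)
qed

section \<open>Explicit form of the thresholded distribution\<close>

text \<open>These are the masses of the fibres of the thresholding map: on the support,
  \<open>g\<close> collects itself and the light strategies, every other heavy strategy only itself,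
  and a light one nothing. This is the form in which a program can compute the distribution.\<close>

lemma pmf_map_threshold:
  fixes p :: "nat pmf"
  assumes "set_pmf p \<subseteq> {..<k}" "\<tau> \<le> pmf p g"
  shows "pmf (map_pmf (\<lambda>a. if pmf p a < \<tau> then g else a) p) a =
    (if a = g then pmf p g + (\<Sum>b | b < k \<and> pmf p b < \<tau>. pmf p b)
     else if pmf p a < \<tau> then 0 else pmf p a)"
proof -
  define h where "h = (\<lambda>a. if pmf p a < \<tau> then g else a)"
  define bad where "bad = {b. b < k \<and> pmf p b < \<tau>}"
  have finite_bad: "finite bad"
    by (rule finite_subset[of _ "{..<k}"]) (auto simp: bad_def)
  have pmf: "pmf (map_pmf h p) a = measure_pmf.prob p (h -` {a} \<inter> set_pmf p)"
    by (simp add: pmf_map measure_Int_set_pmf)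
  have "pmf (map_pmf h p) a = (if a = g then pmf p g + sum (pmf p) bad
     else if pmf p a < \<tau> then 0 else pmf p a)"
  proof (cases "a = g")
    case True
    have "h b = g \<longleftrightarrow> b = g \<or> pmf p b < \<tau>" for b by (simp add: h_def)
    then have "h -` {a} \<inter> set_pmf p = insert g bad \<inter> set_pmf p"
      using assms True by (auto simp: bad_def)
    then have "pmf (map_pmf h p) a = measure_pmf.prob p (insert g bad)"
      by (simp only: pmf measure_Int_set_pmf)
    also have "\<dots> = sum (pmf p) (insert g bad)"
      by (rule measure_measure_pmf_finite) (simp add: finite_bad)
    also have "\<dots> = pmf p g + sum (pmf p) bad"
      using assms(2) finite_bad by (subst sum.insert) (auto simp: bad_def)
    finally show ?thesis using True by simp
  next
    case False
    have "h -` {a} = (if pmf p a < \<tau> then {} else {a})"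
    proof (rule set_eqI)
      fix b
      show "b \<in> h -` {a} \<longleftrightarrow> b \<in> (if pmf p a < \<tau> then {} else {a})"
        using False by (cases "b = a") (auto simp: h_def)
    qed
    then show ?thesis using False by (simp add: pmf measure_Int_set_pmf measure_pmf_single)
  qed
  then show ?thesis by (simp only: h_def bad_def)
qed

text \<open>Pigeonhole: \<open>k\<close> probabilities that are all below \<open>1 / k\<close>
  cannot sum to 1.\<close>

lemma ex_pmf_ge:
  fixes p :: "nat pmf"
  assumes "set_pmf p \<subseteq> {..<k}" "k \<ge> 1" "\<tau> \<le> 1 / real k"
  shows "\<exists>a<k. \<tau> \<le> pmf p a"
proof (rule ccontr)
  assume "\<not> ?thesis"
  then have "(\<Sum>a<k. pmf p a) < (\<Sum>a<k. 1 / real k)"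
    using assms by (intro sum_strict_mono) (auto simp: lessThan_empty_iff)
  then show False using assms by (simp add: sum_pmf_eq_1)
qed

section \<open>Running times of programs\<close>

text \<open>Total correctness with an upper bound on the time. The existential quantifier suffices
  because executions are deterministic.\<close>

definition runs :: "prog \<Rightarrow> state \<Rightarrow> nat \<Rightarrow> (state \<Rightarrow> bool) \<Rightarrow> bool" where
  "runs P \<sigma> T Q \<longleftrightarrow> (\<exists>t \<sigma>'. exec P \<sigma> t \<sigma>' \<and> t \<le> T \<and> Q \<sigma>')"

lemma runs_mono: "runs P \<sigma> T Q \<Longrightarrow> T \<le> T' \<Longrightarrow> (\<And>\<sigma>'. Q \<sigma>' \<Longrightarrow> Q' \<sigma>') \<Longrightarrow> runs P \<sigma> T' Q'"
  unfolding runs_def by (meson le_trans)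

lemma runs_Skip: "Q \<sigma> \<Longrightarrow> runs Skip \<sigma> (Suc 0) Q"
  unfolding runs_def using exec.Skip by fastforce

lemma runs_IAssign:
  "Q (set_int v (map (ival \<sigma>) es) (ival \<sigma> e) \<sigma>) \<Longrightarrow> runs (IAssign v es e) \<sigma> (Suc 0) Q"
  unfolding runs_def using exec.IAssign by fastforce

lemma runs_RAssign:
  "Q (set_real v (map (ival \<sigma>) es) (rval \<sigma> e) \<sigma>) \<Longrightarrow> runs (RAssign v es e) \<sigma> (Suc 0) Q"
  unfolding runs_def using exec.RAssign by fastforce

lemma runs_Seq:
  "runs P \<sigma> T R \<Longrightarrow> (\<And>\<sigma>'. R \<sigma>' \<Longrightarrow> runs P' \<sigma>' T' Q) \<Longrightarrow> runs (Seq P P') \<sigma> (T + T') Q"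
  unfolding runs_def by (meson exec.Seq add_mono)

lemma runs_Cond:
  "(bval \<sigma> b \<Longrightarrow> runs P \<sigma> T Q) \<Longrightarrow> (\<not> bval \<sigma> b \<Longrightarrow> runs P' \<sigma> T Q) \<Longrightarrow> runs (Cond b P P') \<sigma> (Suc T) Q"
  unfolding runs_def using exec.CondTrue exec.CondFalse
  by (cases "bval \<sigma> b") (metis Suc_eq_plus1_left not_less_eq_eq)+

text \<open>The invariant is indexed by the number of completed rounds, so \<open>N - i\<close>
  decreases. Each round pays 1 for its test, and the final failing test costs 1 more.\<close>

lemma runs_Loop:
  assumes inv: "\<And>\<sigma> i. i < N \<Longrightarrow> I i \<sigma> \<Longrightarrow> bval \<sigma> b \<and> runs P \<sigma> T (I (Suc i))"
    and stop: "\<And>\<sigma>. I N \<sigma> \<Longrightarrow> \<not> bval \<sigma> b"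
    and "I i \<sigma>" "i \<le> N"
  shows "runs (Loop b P) \<sigma> ((N - i) * (T + 1) + 1) (I N)"
  using assms(3,4)
proof (induction "N - i" arbitrary: i \<sigma>)
  case 0
  then have "i = N" by simp
  with 0 show ?case unfolding runs_def using exec.LoopFalse[OF stop, of \<sigma>] by auto
next
  case (Suc d)
  then have i: "i < N" by simp
  with inv[OF i] Suc.prems have b: "bval \<sigma> b" and "runs P \<sigma> T (I (Suc i))" by auto
  then obtain t \<sigma>' where P: "exec P \<sigma> t \<sigma>'" "t \<le> T" "I (Suc i) \<sigma>'" by (auto simp: runs_def)
  have "runs (Loop b P) \<sigma>' ((N - Suc i) * (T + 1) + 1) (I N)"
    using Suc(1)[of "Suc i" \<sigma>'] Suc(2) P i by simp
  then obtain t' \<sigma>'' where L: "exec (Loop b P) \<sigma>' t' \<sigma>''" "t' \<le> (N - Suc i) * (T + 1) + 1" "I N \<sigma>''"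
    by (auto simp: runs_def)
  have "N - i = Suc (N - Suc i)" using i by simp
  then have "1 + t + t' \<le> (N - i) * (T + 1) + 1" using P(2) L(2) by simp
  then show ?case unfolding runs_def using exec.LoopTrue[OF b P(1) L(1)] L(3) by blast
qed

lemma set_int_sel [simp]:
  "ints (set_int v is m \<sigma>) = (ints \<sigma>)(v := (ints \<sigma> v)(is := m))"
  "reals (set_int v is m \<sigma>) = reals \<sigma>"
  by (simp_all add: set_int_def)

lemma set_real_sel [simp]:
  "reals (set_real v is r \<sigma>) = (reals \<sigma>)(v := (reals \<sigma> v)(is := r))"
  "ints (set_real v is r \<sigma>) = ints \<sigma>"
  by (simp_all add: set_real_def)

lemma set_int_set_int [simp]: "set_int v is m (set_int v is m' \<sigma>) = set_int v is m \<sigma>"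
  by (simp add: set_int_def)

section \<open>Variables that a program does not mention\<close>

fun iexp_vars :: "iexp \<Rightarrow> string set" where
  "iexp_vars (IConst m) = {}"
| "iexp_vars (IRef v es) = insert v (\<Union>e\<in>set es. iexp_vars e)"
| "iexp_vars (IAdd e e') = iexp_vars e \<union> iexp_vars e'"
| "iexp_vars (ISub e e') = iexp_vars e \<union> iexp_vars e'"

fun rexp_vars :: "rexp \<Rightarrow> string set" where
  "rexp_vars (RConst q) = {}"
| "rexp_vars (RRef v es) = insert v (\<Union>e\<in>set es. iexp_vars e)"
| "rexp_vars (ROfNat e) = iexp_vars e"
| "rexp_vars (RAdd e e') = rexp_vars e \<union> rexp_vars e'"
| "rexp_vars (RSub e e') = rexp_vars e \<union> rexp_vars e'"
| "rexp_vars (RMul e e') = rexp_vars e \<union> rexp_vars e'"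
| "rexp_vars (RDiv e e') = rexp_vars e \<union> rexp_vars e'"

fun bexp_vars :: "bexp \<Rightarrow> string set" where
  "bexp_vars (ILess e e') = iexp_vars e \<union> iexp_vars e'"
| "bexp_vars (RLess e e') = rexp_vars e \<union> rexp_vars e'"
| "bexp_vars (BNot b) = bexp_vars b"
| "bexp_vars (BAnd b b') = bexp_vars b \<union> bexp_vars b'"

fun prog_vars :: "prog \<Rightarrow> string set" where
  "prog_vars Skip = {}"
| "prog_vars (IAssign v es e) = insert v ((\<Union>e\<in>set es. iexp_vars e) \<union> iexp_vars e)"
| "prog_vars (RAssign v es e) = insert v ((\<Union>e\<in>set es. iexp_vars e) \<union> rexp_vars e)"
| "prog_vars (Seq P Q) = prog_vars P \<union> prog_vars Q"
| "prog_vars (Cond b P Q) = bexp_vars b \<union> prog_vars P \<union> prog_vars Q"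
| "prog_vars (Loop b P) = bexp_vars b \<union> prog_vars P"

lemma finite_iexp_vars: "finite (iexp_vars e)"
  by (induction e rule: iexp_vars.induct) auto

lemma finite_rexp_vars: "finite (rexp_vars e)"
  by (induction e) (auto simp: finite_iexp_vars)

lemma finite_bexp_vars: "finite (bexp_vars b)"
  by (induction b) (auto simp: finite_iexp_vars finite_rexp_vars)

text \<open>Guarantees that some array name is fresh for a given program.\<close>

lemma finite_prog_vars: "finite (prog_vars P)"
  by (induction P) (auto simp: finite_iexp_vars finite_rexp_vars finite_bexp_vars)

definition agree_off :: "string \<Rightarrow> state \<Rightarrow> state \<Rightarrow> bool" where
  "agree_off w \<sigma> \<rho> \<longleftrightarrow> (\<forall>v. v \<noteq> w \<longrightarrow> ints \<sigma> v = ints \<rho> v \<and> reals \<sigma> v = reals \<rho> v)"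

lemma ival_agree_off:
  assumes "agree_off w \<sigma> \<rho>"
  shows "w \<notin> iexp_vars e \<Longrightarrow> ival \<sigma> e = ival \<rho> e"
proof (induction e rule: iexp_vars.induct)
  case (2 v es)
  then have "map (ival \<sigma>) es = map (ival \<rho>) es" by auto
  moreover have "v \<noteq> w" using 2 by auto
  then have "ints \<sigma> v = ints \<rho> v" using assms by (simp add: agree_off_def)
  ultimately show ?case by (simp only: ival.simps)
qed auto

lemma map_ival_agree_off:
  assumes "agree_off w \<sigma> \<rho>" "w \<notin> (\<Union>e\<in>set es. iexp_vars e)"
  shows "map (ival \<sigma>) es = map (ival \<rho>) es"
  using assms ival_agree_off by auto

lemma rval_agree_off:
  assumes "agree_off w \<sigma> \<rho>"
  shows "w \<notin> rexp_vars e \<Longrightarrow> rval \<sigma> e = rval \<rho> e"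
proof (induction e)
  case (RRef v es)
  then have "map (ival \<sigma>) es = map (ival \<rho>) es" using assms by (intro map_ival_agree_off) auto
  moreover have "v \<noteq> w" using RRef by auto
  then have "reals \<sigma> v = reals \<rho> v" using assms by (simp add: agree_off_def)
  ultimately show ?case by (simp only: rval.simps)
qed (use assms ival_agree_off in auto)

lemma bval_agree_off:
  assumes "agree_off w \<sigma> \<rho>"
  shows "w \<notin> bexp_vars b \<Longrightarrow> bval \<sigma> b = bval \<rho> b"
  by (induction b) (use assms ival_agree_off[OF assms] rval_agree_off[OF assms] in auto)

definition same_at :: "string \<Rightarrow> state \<Rightarrow> state \<Rightarrow> bool" where
  "same_at w \<sigma> \<rho> \<longleftrightarrow> ints \<sigma> w = ints \<rho> w \<and> reals \<sigma> w = reals \<rho> w"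

text \<open>A lockstep simulation: no expression of \<open>P\<close> reads \<open>w\<close> and no
  assignment writes it. So a program specified on a clean input behaves the same, in the same time,
  when \<open>w\<close> holds foreign data, and those data survive.\<close>

lemma exec_agree_off:
  "exec P \<sigma> t \<sigma>' \<Longrightarrow> w \<notin> prog_vars P \<Longrightarrow> agree_off w \<sigma> \<rho> \<Longrightarrow>
    \<exists>\<rho>'. exec P \<rho> t \<rho>' \<and> agree_off w \<sigma>' \<rho>' \<and> same_at w \<rho>' \<rho>"
proof (induction arbitrary: \<rho> rule: exec.induct)
  case (Skip \<sigma>)
  then show ?case using exec.Skip by (auto simp: same_at_def)
next
  case (IAssign v es e \<sigma>)
  have "map (ival \<sigma>) es = map (ival \<rho>) es" "ival \<sigma> e = ival \<rho> e"
    using IAssign.prems by (auto intro!: map_ival_agree_off[of w] ival_agree_off[of w] simp del: map_eq_conv)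
  then have "agree_off w (set_int v (map (ival \<sigma>) es) (ival \<sigma> e) \<sigma>)
      (set_int v (map (ival \<rho>) es) (ival \<rho> e) \<rho>)"
    using IAssign.prems by (simp only: agree_off_def set_int_sel set_real_sel) simp
  moreover have "same_at w (set_int v (map (ival \<rho>) es) (ival \<rho> e) \<rho>) \<rho>"
    using IAssign.prems by (auto simp: same_at_def)
  ultimately show ?case using exec.IAssign by blast
next
  case (RAssign v es e \<sigma>)
  have "map (ival \<sigma>) es = map (ival \<rho>) es" "rval \<sigma> e = rval \<rho> e"
    using RAssign.prems by (auto intro!: map_ival_agree_off[of w] rval_agree_off[of w] simp del: map_eq_conv)
  then have "agree_off w (set_real v (map (ival \<sigma>) es) (rval \<sigma> e) \<sigma>)
      (set_real v (map (ival \<rho>) es) (rval \<rho> e) \<rho>)"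
    using RAssign.prems by (simp only: agree_off_def set_int_sel set_real_sel) simp
  moreover have "same_at w (set_real v (map (ival \<rho>) es) (rval \<rho> e) \<rho>) \<rho>"
    using RAssign.prems by (auto simp: same_at_def)
  ultimately show ?case using exec.RAssign by blast
next
  case (Seq P \<sigma> t \<sigma>' Q t' \<sigma>'')
  from Seq.IH(1)[of \<rho>] Seq.prems obtain \<rho>' where
    1: "exec P \<rho> t \<rho>'" "agree_off w \<sigma>' \<rho>'" "same_at w \<rho>' \<rho>" by auto
  from Seq.IH(2)[of \<rho>'] Seq.prems 1 obtain \<rho>'' where
    2: "exec Q \<rho>' t' \<rho>''" "agree_off w \<sigma>'' \<rho>''" "same_at w \<rho>'' \<rho>'" by auto
  then show ?case using exec.Seq[OF 1(1) 2(1)] 1(3) by (auto simp: same_at_def)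
next
  case (CondTrue \<sigma> b P t \<sigma>' Q)
  then show ?case using bval_agree_off[of w \<sigma> \<rho> b] exec.CondTrue[of \<rho> b P t _ Q] by fastforce
next
  case (CondFalse \<sigma> b Q t \<sigma>' P)
  then show ?case using bval_agree_off[of w \<sigma> \<rho> b] exec.CondFalse[of \<rho> b Q t _ P] by fastforce
next
  case (LoopFalse \<sigma> b P)
  then show ?case using bval_agree_off[of w \<sigma> \<rho> b] exec.LoopFalse[of \<rho> b P] by (auto simp: same_at_def)
next
  case (LoopTrue \<sigma> b P t \<sigma>' t' \<sigma>'')
  from LoopTrue.IH(1)[of \<rho>] LoopTrue.prems obtain \<rho>' where
    1: "exec P \<rho> t \<rho>'" "agree_off w \<sigma>' \<rho>'" "same_at w \<rho>' \<rho>" by auto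
  from LoopTrue.IH(2)[of \<rho>'] LoopTrue.prems 1 obtain \<rho>'' where
    2: "exec (Loop b P) \<rho>' t' \<rho>''" "agree_off w \<sigma>'' \<rho>''" "same_at w \<rho>'' \<rho>'" by auto
  have "bval \<rho> b" using LoopTrue.hyps(1) LoopTrue.prems bval_agree_off[of w \<sigma> \<rho> b] by auto
  then show ?case using exec.LoopTrue[OF _ 1(1) 2(1)] 1(3) 2 by (auto simp: same_at_def)
qed

section \<open>Nested loops\<close>

text \<open>All scratch data live in one array \<open>w\<close>: the natural cells 0 and 1 hold the old and the new
  number of players, cells from 2 on hold loop counters, and the real cell 0 holds the
  threshold.\<close>

abbreviation cell :: "string \<Rightarrow> nat \<Rightarrow> iexp" where
  "cell w c \<equiv> IRef w [IConst c]"

text \<open>The bound is read from cell 1, since the size of the padded game is known only at run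
  time.\<close>

definition For :: "string \<Rightarrow> nat \<Rightarrow> prog \<Rightarrow> prog" where
  "For w c P = Seq (IAssign w [IConst c] (IConst 0))
     (Loop (ILess (cell w c) (cell w 1))
        (Seq P (IAssign w [IConst c] (IAdd (cell w c) (IConst 1)))))"

text \<open>Each round costs \<open>T\<close>, a test and an increment; the initialization and the
  last test give the final 2. The invariant for \<open>Suc i\<close> is demanded after the
  increment.\<close>

lemma runs_For:
  assumes init: "I 0 (set_int w [c] 0 \<sigma>)"
    and bound: "\<And>i \<sigma>. I i \<sigma> \<Longrightarrow> ints \<sigma> w [c] = i \<Longrightarrow> ints \<sigma> w [1] = N"
    and step: "\<And>i \<sigma>. i < N \<Longrightarrow> I i \<sigma> \<Longrightarrow> ints \<sigma> w [c] = i \<Longrightarrow>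
      runs P \<sigma> T (\<lambda>\<sigma>'. ints \<sigma>' w [c] = i \<and> I (Suc i) (set_int w [c] (Suc i) \<sigma>'))"
  shows "runs (For w c P) \<sigma> (N * (T + 2) + 2) (I N)"
proof -
  let ?I = "\<lambda>i \<sigma>. ints \<sigma> w [c] = i \<and> I i \<sigma>"
  have "runs (Loop (ILess (cell w c) (cell w 1))
        (Seq P (IAssign w [IConst c] (IAdd (cell w c) (IConst 1)))))
      (set_int w [c] 0 \<sigma>) ((N - 0) * (T + 1 + 1) + 1) (?I N)"
  proof (rule runs_Loop[where I = ?I])
    fix \<sigma> i assume i: "i < N" "?I i \<sigma>"
    have "runs (Seq P (IAssign w [IConst c] (IAdd (cell w c) (IConst 1)))) \<sigma> (T + 1) (?I (Suc i))"
    proof (rule runs_Seq)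
      show "runs P \<sigma> T (\<lambda>\<sigma>'. ints \<sigma>' w [c] = i \<and> I (Suc i) (set_int w [c] (Suc i) \<sigma>'))"
        using step i by simp
    qed (auto intro!: runs_IAssign)
    then show "bval \<sigma> (ILess (cell w c) (cell w 1)) \<and>
        runs (Seq P (IAssign w [IConst c] (IAdd (cell w c) (IConst 1)))) \<sigma> (T + 1) (?I (Suc i))"
      using i bound[of i \<sigma>] by simp
  next
    fix \<sigma> assume "?I N \<sigma>"
    then show "\<not> bval \<sigma> (ILess (cell w c) (cell w 1))" using bound[of N \<sigma>] by simp
  qed (use init in auto)
  then have "runs (For w c P) \<sigma> (1 + ((N - 0) * (T + 1 + 1) + 1)) (?I N)"
    unfolding For_def by (intro runs_Seq[where R = "\<lambda>\<sigma>'. \<sigma>' = set_int w [c] 0 \<sigma>"])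
      (auto intro!: runs_IAssign)
  then show ?thesis by (rule runs_mono) auto
qed

text \<open>The table has \<open>k + 2\<close> index positions, so the nest is generated by
  recursion on the depth. The outermost loop owns the highest cell, that is, the last index.\<close>

primrec Nest :: "string \<Rightarrow> nat \<Rightarrow> prog \<Rightarrow> prog" where
  "Nest w 0 P = P"
| "Nest w (Suc j) P = For w (2 + j) (Nest w j P)"

primrec nest_time :: "nat \<Rightarrow> nat \<Rightarrow> nat \<Rightarrow> nat" where
  "nest_time N T 0 = T"
| "nest_time N T (Suc j) = N * (nest_time N T j + 2) + 2"

definition index_box :: "nat \<Rightarrow> nat \<Rightarrow> nat list set" where
  "index_box N d = {xs. length xs = d \<and> set xs \<subseteq> {..<N}}"

definition counters :: "string \<Rightarrow> nat \<Rightarrow> state \<Rightarrow> nat list" where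
  "counters w d \<sigma> = map (\<lambda>j. ints \<sigma> w [2 + j]) [0..<d]"

lemma index_box_Suc: "index_box N (Suc j) = (\<Union>x<N. (\<lambda>xs. xs @ [x]) ` index_box N j)"
proof (intro equalityI subsetI)
  fix xs assume "xs \<in> index_box N (Suc j)"
  then obtain ys y where "xs = ys @ [y]" by (cases xs rule: rev_cases) (auto simp: index_box_def)
  with \<open>xs \<in> index_box N (Suc j)\<close> show "xs \<in> (\<Union>x<N. (\<lambda>xs. xs @ [x]) ` index_box N j)"
    by (auto simp: index_box_def)
qed (auto simp: index_box_def)

text \<open>The invariant carries the set of index lists already handled, so the order of traversal
  is irrelevant. A nest of depth \<open>j\<close> sees the counters from \<open>j\<close> on as
  fixed and handles all lists ending in them.\<close>

lemma runs_Nest: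
  assumes body: "\<And>A \<sigma>. I A \<sigma> \<Longrightarrow> ints \<sigma> w [1] = N \<Longrightarrow> counters w d \<sigma> \<in> index_box N d \<Longrightarrow>
      runs P \<sigma> T (\<lambda>\<sigma>'. I (insert (counters w d \<sigma>) A) \<sigma>' \<and> ints \<sigma>' w = ints \<sigma> w)"
    and stable: "\<And>A \<sigma> c m. I A \<sigma> \<Longrightarrow> I A (set_int w [2 + c] m \<sigma>)"
  shows "j \<le> d \<Longrightarrow> I A \<sigma> \<Longrightarrow> ints \<sigma> w [1] = N \<Longrightarrow> (\<And>c. c \<ge> j \<Longrightarrow> c < d \<Longrightarrow> ints \<sigma> w [2 + c] < N) \<Longrightarrow>
    runs (Nest w j P) \<sigma> (nest_time N T j)
      (\<lambda>\<sigma>'. I (A \<union> (\<lambda>xs. xs @ map (\<lambda>c. ints \<sigma> w [2 + c]) [j..<d]) ` index_box N j) \<sigma>' \<and>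
         (\<forall>c. c < 2 \<or> 2 + j \<le> c \<longrightarrow> ints \<sigma>' w [c] = ints \<sigma> w [c]))"
proof (induction j arbitrary: A \<sigma>)
  case 0
  have box0: "index_box N 0 = {[]}" by (auto simp: index_box_def)
  have "counters w d \<sigma> \<in> index_box N d" using 0 by (auto simp: counters_def index_box_def)
  then show ?case
    using body[OF 0(2,3)] by (auto simp: box0 counters_def elim!: runs_mono)
next
  case (Suc j)
  let ?y = "\<lambda>x. x # map (\<lambda>c. ints \<sigma> w [2 + c]) [Suc j..<d]"
  \<comment> \<open>The lists handled when the outermost of the \<open>Suc j\<close> loops has
    completed \<open>i\<close> rounds.\<close>
  define S where "S i = A \<union> (\<Union>x<i. (\<lambda>xs. xs @ ?y x) ` index_box N j)" for i
  let ?I = "\<lambda>i \<sigma>'. I (S i) \<sigma>' \<and> (\<forall>c. c < 2 \<or> 2 + Suc j \<le> c \<longrightarrow> ints \<sigma>' w [c] = ints \<sigma> w [c])"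
  have "runs (For w (2 + j) (Nest w j P)) \<sigma> (N * (nest_time N T j + 2) + 2) (?I N)"
  proof (rule runs_For[where I = ?I])
    show "?I 0 (set_int w [2 + j] 0 \<sigma>)" using stable[OF Suc.prems(2)] by (auto simp: S_def)
  next
    fix i \<rho> assume "?I i \<rho>"
    then show "ints \<rho> w [1] = N" using Suc.prems(3) by simp
  next
    fix i \<rho> assume i: "i < N" and I: "?I i \<rho>" and c: "ints \<rho> w [2 + j] = i"
    have same: "ints \<rho> w [2 + c] = ints \<sigma> w [2 + c]" if "Suc j \<le> c" for c using I that by simp
    have "[j..<d] = j # [Suc j..<d]" using Suc.prems(1) by (simp add: upt_rec)
    then have y: "map (\<lambda>c. ints \<rho> w [2 + c]) [j..<d] = ?y i" using c same by simp
    have "S i \<union> (\<lambda>xs. xs @ ?y i) ` index_box N j = S (Suc i)"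
      by (auto simp: S_def lessThan_Suc)
    moreover have "runs (Nest w j P) \<rho> (nest_time N T j)
      (\<lambda>\<sigma>'. I (S i \<union> (\<lambda>xs. xs @ ?y i) ` index_box N j) \<sigma>' \<and>
         (\<forall>c. c < 2 \<or> 2 + j \<le> c \<longrightarrow> ints \<sigma>' w [c] = ints \<rho> w [c]))"
      unfolding y[symmetric]
    proof (rule Suc.IH)
      show "ints \<rho> w [2 + c] < N" if "j \<le> c" "c < d" for c
        using Suc.prems(4)[of c] same[of c] that c i by (cases "c = j") auto
    qed (use Suc.prems I in auto)
    ultimately show "runs (Nest w j P) \<rho> (nest_time N T j)
        (\<lambda>\<sigma>'. ints \<sigma>' w [2 + j] = i \<and> ?I (Suc i) (set_int w [2 + j] (Suc i) \<sigma>'))"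
      using stable I c by (auto elim!: runs_mono)
  qed
  moreover have "S N = A \<union> (\<lambda>xs. xs @ map (\<lambda>c. ints \<sigma> w [2 + c]) [Suc j..<d]) ` index_box N (Suc j)"
    by (auto simp: S_def index_box_Suc image_UN image_image)
  ultimately show ?case by (simp only: Nest.simps nest_time.simps)
qed

section \<open>Writing the table of the padded game\<close>

definition payoff_table ::
    "nat \<Rightarrow> nat \<Rightarrow> (nat \<Rightarrow> nat \<Rightarrow> nat list \<Rightarrow> real) \<Rightarrow> nat list \<Rightarrow> real" where
  "payoff_table n k u is = (case is of
       i # a # x \<Rightarrow> if i < n \<and> a < k \<and> x \<in> partitions (n - 1) k then u i a x else 0
     | _ \<Rightarrow> 0)"

lemma reals_game_input:
  "reals (game_input n k u) v = (if v = ''u'' then payoff_table n k u else (\<lambda>_. 0))"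
  by (auto simp: game_input_def payoff_table_def fun_eq_iff split: list.split)

lemma ints_game_input:
  "ints (game_input n k u) v = (\<lambda>is. if v = ''n'' \<and> is = [] then n else 0)"
  by (simp add: game_input_def)

text \<open>The state while the table is rewritten: apart from the scratch array and the contents \<open>T\<close> of
  the payoff table it is already the input of the padded game.\<close>

definition table_state :: "string \<Rightarrow> nat \<Rightarrow> nat \<Rightarrow> real \<Rightarrow> (nat list \<Rightarrow> real) \<Rightarrow> state \<Rightarrow> bool" where
  "table_state w N n \<tau> T \<sigma> \<longleftrightarrow>
     (\<forall>v. v \<noteq> w \<longrightarrow> ints \<sigma> v = (\<lambda>is. if v = ''n'' \<and> is = [] then N else 0)) \<and>
     (\<forall>v. v \<noteq> w \<and> v \<noteq> ''u'' \<longrightarrow> reals \<sigma> v = (\<lambda>_. 0)) \<and>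
     reals \<sigma> ''u'' = T \<and> ints \<sigma> w [0] = n \<and> ints \<sigma> w [1] = N \<and> reals \<sigma> w [0] = \<tau>"

lemma table_state_set_int:
  "table_state w N n \<tau> T \<sigma> \<Longrightarrow> table_state w N n \<tau> T (set_int w [2 + c] m \<sigma>)"
  by (simp add: table_state_def)

lemma table_state_set_real:
  assumes "table_state w N n \<tau> T \<sigma>" "w \<noteq> ''u''"
  shows "table_state w N n \<tau> (T(is := r)) (set_real ''u'' is r \<sigma>)"
  using assms by (auto simp: table_state_def)

text \<open>A table in the middle of a pass that rewrites \<open>T\<close> into \<open>T'\<close>:
  \<open>A\<close> is the set of cells already visited.\<close>

definition update_on :: "nat list set \<Rightarrow> (nat list \<Rightarrow> real) \<Rightarrow> (nat list \<Rightarrow> real) \<Rightarrow> nat list \<Rightarrow> real" where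
  "update_on A T T' is = (if is \<in> A then T' is else T is)"

lemma update_on_insert: "update_on (insert is A) T T' = (update_on A T T')(is := T' is)"
  by (auto simp: update_on_def)

lemma update_on_trivial: "T is = T' is \<Longrightarrow> update_on (insert is A) T T' = update_on A T T'"
  by (auto simp: update_on_def)

text \<open>Outside the box the two tables agree, so visiting the box rewrites everything. The body
  must be correct for every \<open>A\<close>, hence independent of what has been visited
  before.\<close>

lemma runs_Nest_table:
  assumes body: "\<And>A \<sigma>. table_state w N n \<tau> (update_on A T T') \<sigma> \<Longrightarrow> counters w d \<sigma> \<in> index_box N d \<Longrightarrow>
      runs P \<sigma> t (\<lambda>\<sigma>'. table_state w N n \<tau> (update_on (insert (counters w d \<sigma>) A) T T') \<sigma>' \<and>
        ints \<sigma>' w = ints \<sigma> w)"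
    and outside: "\<And>is. is \<notin> index_box N d \<Longrightarrow> T is = T' is"
    and init: "table_state w N n \<tau> T \<sigma>"
  shows "runs (Nest w d P) \<sigma> (nest_time N t d) (table_state w N n \<tau> T')"
proof -
  have "update_on {} T T' = T" by (auto simp: update_on_def)
  then have *: "table_state w N n \<tau> (update_on {} T T') \<sigma>" using init by simp
  have "update_on (index_box N d) T T' = T'" using outside by (auto simp: update_on_def)
  moreover have "runs (Nest w d P) \<sigma> (nest_time N t d)
      (\<lambda>\<sigma>'. table_state w N n \<tau> (update_on ({} \<union> (\<lambda>xs. xs @ map (\<lambda>c. ints \<sigma> w [2 + c]) [d..<d]) `
          index_box N d) T T') \<sigma>' \<and>
         (\<forall>c. c < 2 \<or> 2 + d \<le> c \<longrightarrow> ints \<sigma>' w [c] = ints \<sigma> w [c]))"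
    by (rule runs_Nest[where I = "\<lambda>A. table_state w N n \<tau> (update_on A T T')"])
      (use body table_state_set_int * init in \<open>auto simp: table_state_def\<close>)
  ultimately show ?thesis by (auto elim!: runs_mono)
qed

section \<open>The two in-place passes over the payoff table\<close>

primrec cell_sum :: "string \<Rightarrow> nat \<Rightarrow> iexp" where
  "cell_sum w 0 = IConst 0"
| "cell_sum w (Suc j) = IAdd (cell_sum w j) (cell w (4 + j))"

definition IEq :: "iexp \<Rightarrow> iexp \<Rightarrow> bexp" where
  "IEq e e' = BAnd (BNot (ILess e e')) (BNot (ILess e' e))"

lemma bval_IEq [simp]: "bval \<sigma> (IEq e e') \<longleftrightarrow> ival \<sigma> e = ival \<sigma> e'"
  by (auto simp: IEq_def)

definition xs_of :: "string \<Rightarrow> nat \<Rightarrow> state \<Rightarrow> nat list" where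
  "xs_of w k \<sigma> = map (\<lambda>j. ints \<sigma> w [4 + j]) [0..<k]"

lemma ival_cell_sum: "ival \<sigma> (cell_sum w k) = sum_list (xs_of w k \<sigma>)"
  by (induction k) (auto simp: xs_of_def)

lemma counters_eq:
  "counters w (k + 2) \<sigma> = ints \<sigma> w [2] # ints \<sigma> w [3] # xs_of w k \<sigma>"
  by (simp add: counters_def xs_of_def map_upt_Suc numeral_2_eq_2 numeral_3_eq_3 numeral_eq_Suc
      del: upt_Suc)

lemma length_xs_of [simp]: "length (xs_of w k \<sigma>) = k"
  by (simp add: xs_of_def)

lemma xs_of_Cons:
  "k \<ge> 1 \<Longrightarrow> xs_of w k \<sigma> = ints \<sigma> w [4] # map (\<lambda>j. ints \<sigma> w [4 + j]) [1..<k]"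
  by (simp add: xs_of_def upt_rec[of 0])

definition cells :: "string \<Rightarrow> nat \<Rightarrow> iexp list" where
  "cells w d = map (\<lambda>j. cell w (2 + j)) [0..<d]"

lemma map_ival_cells: "map (ival \<sigma>) (cells w d) = counters w d \<sigma>"
  by (simp add: cells_def counters_def)

text \<open>All counters run up to \<open>N\<close>, so \<open>a < k\<close> and the total
  \<open>N - 1\<close> are tested here. Cells written have total \<open>N - 1\<close> and cells read
  have total \<open>n - 1\<close>; as \<open>n < N\<close> they never coincide, and the table can be
  rewritten in place.\<close>

definition fill_cell :: "string \<Rightarrow> nat \<Rightarrow> prog" where
  "fill_cell w k =
     Cond (BAnd (IEq (cell_sum w k) (ISub (cell w 1) (IConst 1))) (ILess (cell w 3) (IConst k)))
       (Cond (ILess (cell w 2) (cell w 0))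
          (Cond (BNot (ILess (cell w 4) (ISub (cell w 1) (cell w 0))))
             (RAssign ''u'' (cells w (k + 2))
                (RRef ''u'' (cell w 2 # cell w 3 # ISub (cell w 4) (ISub (cell w 1) (cell w 0))
                   # map (\<lambda>j. cell w (4 + j)) [1..<k])))
             Skip)
          (Cond (IEq (cell w 3) (IConst 0)) (RAssign ''u'' (cells w (k + 2)) (RConst 1)) Skip))
       Skip"

text \<open>Erases every index list of total \<open>n - 1\<close> in the box; none of them belongs
  to the padded table, whose totals are \<open>N - 1\<close>.\<close>

definition clear_cell :: "string \<Rightarrow> nat \<Rightarrow> prog" where
  "clear_cell w k =
     Cond (IEq (cell_sum w k) (ISub (cell w 0) (IConst 1)))
       (RAssign ''u'' (cells w (k + 2)) (RConst 0)) Skip"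

text \<open>The table between the two passes: the cells of the padded game are written, those of the
  original game are still there.\<close>

definition mixed_table ::
    "nat \<Rightarrow> nat \<Rightarrow> nat \<Rightarrow> (nat \<Rightarrow> nat \<Rightarrow> nat list \<Rightarrow> real) \<Rightarrow> nat list \<Rightarrow> real" where
  "mixed_table n N k u is = (case is of
       i # a # x \<Rightarrow> if i < N \<and> a < k \<and> x \<in> partitions (N - 1) k then padded_game n N u i a x
         else payoff_table n k u is
     | _ \<Rightarrow> payoff_table n k u is)"

text \<open>An entry of a partition of \<open>m\<close> is at most \<open>m\<close>, so one common
  bound \<open>N\<close> serves all counters.\<close>

lemma partitions_index_box:
  assumes "i < N" "a < N" "x \<in> partitions m k" "m < N"
  shows "i # a # x \<in> index_box N (k + 2)"
proof -
  have "y < N" if "y \<in> set x" for y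
    using member_le_sum_list[OF that] assms by (simp add: partitions_def)
  then show ?thesis using assms by (auto simp: index_box_def partitions_def)
qed

lemma partitions_disjoint: "x \<in> partitions m k \<Longrightarrow> m \<noteq> m' \<Longrightarrow> x \<notin> partitions m' k"
  by (simp add: partitions_def)

lemma xs_of_partition: "xs_of w k \<sigma> \<in> partitions m k \<longleftrightarrow> ival \<sigma> (cell_sum w k) = m"
  by (simp add: ival_cell_sum partitions_def)

lemma runs_fill_cell:
  assumes st: "table_state w N n \<tau> (update_on A (payoff_table n k u) (mixed_table n N k u)) \<sigma>"
    and w: "w \<noteq> ''u''" and n: "1 \<le> n" "n < N" and k: "1 \<le> k" and i: "ints \<sigma> w [2] < N"
  shows "runs (fill_cell w k) \<sigma> 4 (\<lambda>\<sigma>'.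
    table_state w N n \<tau> (update_on (insert (counters w (k + 2) \<sigma>) A)
       (payoff_table n k u) (mixed_table n N k u)) \<sigma>' \<and> ints \<sigma>' w = ints \<sigma> w)"
proof -
  let ?T = "payoff_table n k u" and ?T' = "mixed_table n N k u"
  define js where "js = counters w (k + 2) \<sigma>"
  have js_eq: "js = ints \<sigma> w [2] # ints \<sigma> w [3] # xs_of w k \<sigma>"
    unfolding js_def by (rule counters_eq)
  let ?Q = "\<lambda>\<sigma>'. table_state w N n \<tau> (update_on (insert js A) ?T ?T') \<sigma>' \<and> ints \<sigma>' w = ints \<sigma> w"
  have w01: "ints \<sigma> w [0] = n" "ints \<sigma> w [Suc 0] = N" and u: "reals \<sigma> ''u'' = update_on A ?T ?T'"
    using st by (auto simp: table_state_def)
  have T: "?T js = (if ints \<sigma> w [2] < n \<and> ints \<sigma> w [3] < k \<and> ival \<sigma> (cell_sum w k) = n - 1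
      then u (ints \<sigma> w [2]) (ints \<sigma> w [3]) (xs_of w k \<sigma>) else 0)"
    by (simp add: js_eq payoff_table_def xs_of_partition)
  have T': "?T' js = (if ints \<sigma> w [3] < k \<and> ival \<sigma> (cell_sum w k) = N - 1
      then padded_game n N u (ints \<sigma> w [2]) (ints \<sigma> w [3]) (xs_of w k \<sigma>) else ?T js)"
    using i by (simp add: js_eq mixed_table_def xs_of_partition)
  have hd: "hd (xs_of w k \<sigma>) = ints \<sigma> w [4]" using k by (simp add: xs_of_Cons)
  have skip: "runs Skip \<sigma> (Suc 0) ?Q" if "?T js = ?T' js"
    using st by (auto intro!: runs_Skip simp: update_on_trivial[of ?T js ?T'] that)
  have assign: "runs (RAssign ''u'' (cells w (k + 2)) e) \<sigma> (Suc 0) ?Q" if "rval \<sigma> e = ?T' js" for e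
    using table_state_set_real[OF st w, of js "?T' js"] w that
    by (intro runs_RAssign) (simp_all add: map_ival_cells js_def[symmetric] update_on_insert del: add_2_eq_Suc')
  have ne: "N - 1 \<noteq> n - 1" using n by simp
  have "runs (fill_cell w k) \<sigma> (Suc (Suc (Suc (Suc 0)))) ?Q"
  proof (cases "ival \<sigma> (cell_sum w k) = N - 1 \<and> ints \<sigma> w [3] < k")
    case False
    then have "runs (fill_cell w k) \<sigma> (Suc (Suc 0)) ?Q"
      unfolding fill_cell_def by (intro runs_Cond skip) (auto simp: w01 T')
    then show ?thesis by (rule runs_mono) auto
  next
    case True
    show ?thesis unfolding fill_cell_def
    proof (intro runs_Cond)
      assume lt: "bval \<sigma> (ILess (cell w 2) (cell w 0))"
        and ge: "bval \<sigma> (BNot (ILess (cell w 4) (ISub (cell w 1) (cell w 0))))"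
      let ?src = "(ints \<sigma> w [4] - (N - n)) # tl (xs_of w k \<sigma>)"
      have "?src \<in> partitions (n - 1) k"
        using True ge n k unfolding ival_cell_sum
        by (auto simp: partitions_def w01 xs_of_Cons[OF k])
      \<comment> \<open>The source has total \<open>n - 1\<close>, where both tables hold the
        original payoff, so it does not matter whether it lies in \<open>A\<close>.\<close>
      then have "update_on A ?T ?T' (ints \<sigma> w [2] # ints \<sigma> w [3] # ?src)
          = u (ints \<sigma> w [2]) (ints \<sigma> w [3]) ?src"
        using partitions_disjoint[of ?src "n - 1" k "N - 1"] ne True lt
        by (auto simp: update_on_def mixed_table_def payoff_table_def w01)
      moreover have "map (ival \<sigma>) (cell w 2 # cell w 3 # ISub (cell w 4) (ISub (cell w 1) (cell w 0))
          # map (\<lambda>j. cell w (4 + j)) [1..<k]) = ints \<sigma> w [2] # ints \<sigma> w [3] # ?src"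
        by (simp add: w01 xs_of_Cons[OF k] comp_def)
      ultimately show "runs (RAssign ''u'' (cells w (k + 2))
          (RRef ''u'' (cell w 2 # cell w 3 # ISub (cell w 4) (ISub (cell w 1) (cell w 0))
                   # map (\<lambda>j. cell w (4 + j)) [1..<k]))) \<sigma> (Suc 0) ?Q"
        using True lt ge by (intro assign)
          (simp only: rval.simps u, simp add: T' w01 padded_game_def hd)
    next
      assume "bval \<sigma> (ILess (cell w 2) (cell w 0))"
        and "\<not> bval \<sigma> (BNot (ILess (cell w 4) (ISub (cell w 1) (cell w 0))))"
      \<comment> \<open>The new value is the default 0, and the old one is 0 too because the total
        \<open>N - 1\<close> differs from \<open>n - 1\<close>.\<close>
      then have "?T js = ?T' js" using True ne by (simp add: T T' w01 padded_game_def hd)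
      then show "runs Skip \<sigma> (Suc 0) ?Q" by (rule skip)
    next
      assume "\<not> bval \<sigma> (ILess (cell w 2) (cell w 0))" "bval \<sigma> (IEq (cell w 3) (IConst 0))"
      then have "rval \<sigma> (RConst 1) = ?T' js" using True by (simp add: T' w01 padded_game_def)
      then show "runs (RAssign ''u'' (cells w (k + 2)) (RConst 1)) \<sigma> (Suc 0) ?Q" by (rule assign)
    next
      assume "\<not> bval \<sigma> (ILess (cell w 2) (cell w 0))" "\<not> bval \<sigma> (IEq (cell w 3) (IConst 0))"
      then have "?T js = ?T' js" using True by (simp add: T T' w01 padded_game_def)
      then show "runs Skip \<sigma> (Suc 0) ?Q" by (rule skip)
    qed (use True in \<open>auto simp: w01\<close>)
  qed
  then show ?thesis unfolding js_def by (rule runs_mono) auto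
qed

lemma runs_clear_cell:
  assumes st: "table_state w N n \<tau>
      (update_on A (mixed_table n N k u) (payoff_table N k (padded_game n N u))) \<sigma>"
    and w: "w \<noteq> ''u''" and n: "1 \<le> n" "n < N"
  shows "runs (clear_cell w k) \<sigma> 2 (\<lambda>\<sigma>'.
    table_state w N n \<tau> (update_on (insert (counters w (k + 2) \<sigma>) A)
       (mixed_table n N k u) (payoff_table N k (padded_game n N u))) \<sigma>' \<and> ints \<sigma>' w = ints \<sigma> w)"
proof -
  let ?T = "mixed_table n N k u" and ?T' = "payoff_table N k (padded_game n N u)"
  define js where "js = counters w (k + 2) \<sigma>"
  have js_eq: "js = ints \<sigma> w [2] # ints \<sigma> w [3] # xs_of w k \<sigma>"
    unfolding js_def by (rule counters_eq)
  let ?Q = "\<lambda>\<sigma>'. table_state w N n \<tau> (update_on (insert js A) ?T ?T') \<sigma>' \<and> ints \<sigma>' w = ints \<sigma> w"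
  have w0: "ints \<sigma> w [0] = n" using st by (auto simp: table_state_def)
  have ne: "N - 1 \<noteq> n - 1" using n by simp
  have "runs (clear_cell w k) \<sigma> (Suc (Suc 0)) ?Q"
    unfolding clear_cell_def
  proof (intro runs_Cond)
    assume "bval \<sigma> (IEq (cell_sum w k) (ISub (cell w 0) (IConst 1)))"
    then have "?T' js = 0"
      using ne by (simp add: js_eq payoff_table_def xs_of_partition w0)
    then show "runs (RAssign ''u'' (cells w (k + 2)) (RConst 0)) \<sigma> (Suc 0) ?Q"
      using table_state_set_real[OF st w, of js "?T' js"] w
      by (intro runs_RAssign) (simp_all add: map_ival_cells js_def[symmetric] update_on_insert del: add_2_eq_Suc')
  next
    assume "\<not> bval \<sigma> (IEq (cell_sum w k) (ISub (cell w 0) (IConst 1)))"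
    then have "?T js = ?T' js"
      by (simp add: js_eq payoff_table_def mixed_table_def xs_of_partition w0)
    then show "runs Skip \<sigma> (Suc 0) ?Q"
      using st by (auto intro!: runs_Skip simp: update_on_trivial[of ?T js ?T'])
  qed
  then show ?thesis unfolding js_def by (rule runs_mono) auto
qed

text \<open>All three tables vanish outside the box: \<open>n < N\<close> covers players and counts,
  \<open>k \<le> N\<close> covers strategies.\<close>

lemma runs_build_padded:
  assumes st: "table_state w N n \<tau> (payoff_table n k u) \<sigma>"
    and w: "w \<noteq> ''u''" and n: "1 \<le> n" "n < N" and k: "1 \<le> k" "k \<le> N"
  shows "runs (Seq (Nest w (k + 2) (fill_cell w k)) (Nest w (k + 2) (clear_cell w k))) \<sigma>
    (nest_time N 4 (k + 2) + nest_time N 2 (k + 2))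
    (table_state w N n \<tau> (payoff_table N k (padded_game n N u)))"
proof (rule runs_Seq)
  have old: "payoff_table n k u js = 0" if "js \<notin> index_box N (k + 2)" for js
    using that n k partitions_index_box[of _ N _ _ "n - 1" k]
    by (auto simp: payoff_table_def simp del: add_2_eq_Suc' split: list.split)
  have mixed: "mixed_table n N k u js = 0" if "js \<notin> index_box N (k + 2)" for js
    using that old[OF that] n k partitions_index_box[of _ N _ _ "N - 1" k]
    by (auto simp: mixed_table_def simp del: add_2_eq_Suc' split: list.split)
  have new: "payoff_table N k (padded_game n N u) js = 0" if "js \<notin> index_box N (k + 2)" for js
    using that n k partitions_index_box[of _ N _ _ "N - 1" k]
    by (auto simp: payoff_table_def simp del: add_2_eq_Suc' split: list.split)
  let ?T = "mixed_table n N k u"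
  show "runs (Nest w (k + 2) (fill_cell w k)) \<sigma> (nest_time N 4 (k + 2)) (table_state w N n \<tau> ?T)"
  proof (rule runs_Nest_table[OF _ _ st])
    fix js assume "js \<notin> index_box N (k + 2)"
    then show "payoff_table n k u js = ?T js" by (simp only: old mixed simp_thms)
  next
    fix A \<rho> assume "table_state w N n \<tau> (update_on A (payoff_table n k u) (mixed_table n N k u)) \<rho>"
      and "counters w (k + 2) \<rho> \<in> index_box N (k + 2)"
    moreover from this(2) have "ints \<rho> w [2] < N"
      unfolding counters_eq by (simp add: index_box_def)
    ultimately show "runs (fill_cell w k) \<rho> 4 (\<lambda>\<sigma>'. table_state w N n \<tau>
        (update_on (insert (counters w (k + 2) \<rho>) A) (payoff_table n k u) (mixed_table n N k u)) \<sigma>' \<and>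
        ints \<sigma>' w = ints \<rho> w)"
      using w n k by (intro runs_fill_cell)
  qed
  show "runs (Nest w (k + 2) (clear_cell w k)) \<rho> (nest_time N 2 (k + 2))
      (table_state w N n \<tau> (payoff_table N k (padded_game n N u)))"
    if "table_state w N n \<tau> (mixed_table n N k u) \<rho>" for \<rho>
    by (rule runs_Nest_table[OF runs_clear_cell _ that]) (simp_all only: w n new mixed simp_thms)
qed

section \<open>Thresholding the computed profile\<close>

primrec pick_heavy :: "string \<Rightarrow> nat \<Rightarrow> prog" where
  "pick_heavy w 0 = Skip"
| "pick_heavy w (Suc a) = Seq (pick_heavy w a)
     (Cond (RLess (RRef ''s'' [cell w 2, IConst a]) (RRef w [IConst 0])) Skip
        (IAssign w [IConst 3] (IConst a)))"

text \<open>Unrolled over the constant number of strategies, the search leaves the last heavy one in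
  cell 3. The first alternative, that none has been met, is excluded later by
  \<open>ex_pmf_ge\<close>.\<close>

lemma runs_pick_heavy:
  assumes "\<And>a. a < m \<Longrightarrow> reals \<sigma> ''s'' [ints \<sigma> w [2], a] = p a" "reals \<sigma> w [0] = \<tau>"
  shows "runs (pick_heavy w m) \<sigma> (2 * m + 1)
    (\<lambda>\<sigma>'. \<sigma>' = \<sigma> \<and> (\<forall>a<m. p a < \<tau>) \<or> (\<exists>g<m. \<tau> \<le> p g \<and> \<sigma>' = set_int w [3] g \<sigma>))"
  using assms(1)
proof (induction m)
  case 0
  then show ?case by (auto intro: runs_Skip)
next
  case (Suc m)
  have "runs (pick_heavy w (Suc m)) \<sigma> ((2 * m + 1) + Suc (Suc 0))
    (\<lambda>\<sigma>'. \<sigma>' = \<sigma> \<and> (\<forall>a<Suc m. p a < \<tau>) \<or> (\<exists>g<Suc m. \<tau> \<le> p g \<and> \<sigma>' = set_int w [3] g \<sigma>))"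
    unfolding pick_heavy.simps
  proof (rule runs_Seq[OF Suc.IH])
    fix \<sigma>' :: state assume *: "\<sigma>' = \<sigma> \<and> (\<forall>a<m. p a < \<tau>) \<or> (\<exists>g<m. \<tau> \<le> p g \<and> \<sigma>' = set_int w [3] g \<sigma>)"
    then have p: "rval \<sigma>' (RRef ''s'' [cell w 2, IConst m]) = p m" "rval \<sigma>' (RRef w [IConst 0]) = \<tau>"
      using Suc.prems[of m] assms(2) by auto
    show "runs (Cond (RLess (RRef ''s'' [cell w 2, IConst m]) (RRef w [IConst 0])) Skip
        (IAssign w [IConst 3] (IConst m))) \<sigma>' (Suc (Suc 0))
      (\<lambda>\<sigma>'. \<sigma>' = \<sigma> \<and> (\<forall>a<Suc m. p a < \<tau>) \<or> (\<exists>g<Suc m. \<tau> \<le> p g \<and> \<sigma>' = set_int w [3] g \<sigma>))"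
    proof (rule runs_Cond)
      assume "bval \<sigma>' (RLess (RRef ''s'' [cell w 2, IConst m]) (RRef w [IConst 0]))"
      then have "p m < \<tau>" using p by (simp only: bval.simps)
      then show "runs Skip \<sigma>' (Suc 0)
        (\<lambda>\<sigma>'. \<sigma>' = \<sigma> \<and> (\<forall>a<Suc m. p a < \<tau>) \<or> (\<exists>g<Suc m. \<tau> \<le> p g \<and> \<sigma>' = set_int w [3] g \<sigma>))"
        using * by (intro runs_Skip) (auto simp: less_Suc_eq)
    next
      assume "\<not> bval \<sigma>' (RLess (RRef ''s'' [cell w 2, IConst m]) (RRef w [IConst 0]))"
      then have "\<tau> \<le> p m" using p by (simp only: bval.simps not_less)
      moreover have "set_int w [3] m \<sigma>' = set_int w [3] m \<sigma>" using * by auto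
      ultimately show "runs (IAssign w [IConst 3] (IConst m)) \<sigma>' (Suc 0)
        (\<lambda>\<sigma>'. \<sigma>' = \<sigma> \<and> (\<forall>a<Suc m. p a < \<tau>) \<or> (\<exists>g<Suc m. \<tau> \<le> p g \<and> \<sigma>' = set_int w [3] g \<sigma>))"
        by (intro runs_IAssign) auto
    qed
  qed (use Suc.prems in auto)
  then show ?case by (rule runs_mono) auto
qed

primrec move_light :: "string \<Rightarrow> nat \<Rightarrow> prog" where
  "move_light w 0 = Skip"
| "move_light w (Suc a) = Seq (move_light w a)
     (Cond (RLess (RRef ''s'' [cell w 2, IConst a]) (RRef w [IConst 0]))
        (Seq (RAssign ''s'' [cell w 2, cell w 3]
               (RAdd (RRef ''s'' [cell w 2, cell w 3]) (RRef ''s'' [cell w 2, IConst a])))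
             (RAssign ''s'' [cell w 2, IConst a] (RConst 0)))
        Skip)"

text \<open>The row after the light entries below \<open>m\<close> have been moved to the heavy entry \<open>g\<close>.\<close>

definition moved :: "(nat \<Rightarrow> real) \<Rightarrow> real \<Rightarrow> nat \<Rightarrow> nat \<Rightarrow> nat \<Rightarrow> real" where
  "moved p \<tau> g m a =
     (if a = g then p g + (\<Sum>b | b < m \<and> p b < \<tau>. p b) else if a < m \<and> p a < \<tau> then 0 else p a)"

text \<open>A light \<open>m\<close> differs from the heavy \<open>g\<close>, so the two updates do
  not collide.\<close>

lemma moved_Suc_light:
  assumes "p m < \<tau>" "\<tau> \<le> p g"
  shows "moved p \<tau> g (Suc m) = (moved p \<tau> g m)(g := moved p \<tau> g m g + moved p \<tau> g m m, m := 0)"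
proof -
  have fin: "finite {b. b < m \<and> p b < \<tau>}" by simp
  have "{b. b < Suc m \<and> p b < \<tau>} = insert m {b. b < m \<and> p b < \<tau>}"
    using assms(1) by (auto simp: less_Suc_eq)
  then have "(\<Sum>b | b < Suc m \<and> p b < \<tau>. p b) = p m + (\<Sum>b | b < m \<and> p b < \<tau>. p b)"
    using fin by (simp add: sum.insert)
  moreover have "m \<noteq> g" using assms by auto
  ultimately show ?thesis using assms by (auto simp: moved_def fun_eq_iff less_Suc_eq)
qed

lemma moved_Suc_heavy:
  assumes "\<not> p m < \<tau>"
  shows "moved p \<tau> g (Suc m) = moved p \<tau> g m"
proof -
  have "b < Suc m \<and> p b < \<tau> \<longleftrightarrow> b < m \<and> p b < \<tau>" for b using assms by (auto simp: less_Suc_eq)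
  then show ?thesis by (simp only: moved_def fun_eq_iff simp_thms)
qed

lemma runs_move_light:
  assumes w: "w \<noteq> ''s''" and g: "ints \<sigma> w [3] = g" "g < k" "\<tau> \<le> p g" and \<tau>: "reals \<sigma> w [0] = \<tau>"
    and p0: "\<And>a. 0 \<le> p a"
    and p: "\<And>a. a < k \<Longrightarrow> reals \<sigma> ''s'' [ints \<sigma> w [2], a] = p a"
  shows "m \<le> k \<Longrightarrow> runs (move_light w m) \<sigma> (3 * m + 1)
    (\<lambda>\<sigma>'. ints \<sigma>' = ints \<sigma> \<and> reals \<sigma>' w = reals \<sigma> w \<and>
       (\<forall>a<k. reals \<sigma>' ''s'' [ints \<sigma> w [2], a] = moved p \<tau> g m a) \<and>
       (\<forall>i a. i \<noteq> ints \<sigma> w [2] \<longrightarrow> reals \<sigma>' ''s'' [i, a] = reals \<sigma> ''s'' [i, a]))"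
proof (induction m)
  case 0
  then show ?case using p by (auto intro!: runs_Skip simp: moved_def)
next
  case (Suc m)
  let ?Q = "\<lambda>m (\<sigma>' :: state). ints \<sigma>' = ints \<sigma> \<and> reals \<sigma>' w = reals \<sigma> w \<and>
       (\<forall>a<k. reals \<sigma>' ''s'' [ints \<sigma> w [2], a] = moved p \<tau> g m a) \<and>
       (\<forall>i a. i \<noteq> ints \<sigma> w [2] \<longrightarrow> reals \<sigma>' ''s'' [i, a] = reals \<sigma> ''s'' [i, a])"
  have "runs (move_light w (Suc m)) \<sigma> ((3 * m + 1) + Suc (Suc 0 + Suc 0)) (?Q (Suc m))"
    unfolding move_light.simps
  proof (rule runs_Seq[OF Suc.IH])
    fix \<sigma>' :: state assume Q: "?Q m \<sigma>'"
    have m: "m < k" using Suc.prems by simp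
    \<comment> \<open>The program tests the current row, not the original \<open>p\<close>. The
      verdict is the same: entry \<open>g\<close> has only grown and stays heavy, and any other
      entry \<open>m\<close> is still untouched.\<close>
    have light: "bval \<sigma>' (RLess (RRef ''s'' [cell w 2, IConst m]) (RRef w [IConst 0])) \<longleftrightarrow> p m < \<tau>"
    proof (cases "m = g")
      case True
      have "0 \<le> (\<Sum>b | b < m \<and> p b < \<tau>. p b)" by (intro sum_nonneg p0)
      moreover have "\<not> p m < \<tau>" using True g(3) by simp
      ultimately show ?thesis using Q m \<tau> g(3) True by (simp add: moved_def)
    next
      case False
      then show ?thesis using Q m \<tau> by (simp add: moved_def)
    qed
    show "runs (Cond (RLess (RRef ''s'' [cell w 2, IConst m]) (RRef w [IConst 0]))
        (Seq (RAssign ''s'' [cell w 2, cell w 3]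
               (RAdd (RRef ''s'' [cell w 2, cell w 3]) (RRef ''s'' [cell w 2, IConst m])))
             (RAssign ''s'' [cell w 2, IConst m] (RConst 0)))
        Skip) \<sigma>' (Suc (Suc 0 + Suc 0)) (?Q (Suc m))"
    proof (rule runs_Cond)
      assume "bval \<sigma>' (RLess (RRef ''s'' [cell w 2, IConst m]) (RRef w [IConst 0]))"
      then have "p m < \<tau>" by (simp only: light)
      then have mv: "moved p \<tau> g (Suc m) = (moved p \<tau> g m)(g := moved p \<tau> g m g + moved p \<tau> g m m, m := 0)"
        using g(3) by (rule moved_Suc_light)
      show "runs (Seq (RAssign ''s'' [cell w 2, cell w 3]
               (RAdd (RRef ''s'' [cell w 2, cell w 3]) (RRef ''s'' [cell w 2, IConst m])))
             (RAssign ''s'' [cell w 2, IConst m] (RConst 0))) \<sigma>' (Suc 0 + Suc 0) (?Q (Suc m))"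
        by (intro runs_Seq[where R = "\<lambda>\<rho>. \<rho> = set_real ''s'' [ints \<sigma> w [2], g]
            (moved p \<tau> g m g + moved p \<tau> g m m) \<sigma>'"] runs_RAssign)
          (use Q m g w in \<open>auto simp: mv intro!: runs_RAssign\<close>)
    next
      assume "\<not> bval \<sigma>' (RLess (RRef ''s'' [cell w 2, IConst m]) (RRef w [IConst 0]))"
      then have "\<not> p m < \<tau>" by (simp only: light simp_thms)
      have "?Q (Suc m) \<sigma>'" using Q unfolding moved_Suc_heavy[of p m \<tau> g, OF \<open>\<not> p m < \<tau>\<close>] .
      then show "runs Skip \<sigma>' (Suc 0 + Suc 0) (?Q (Suc m))"
        by (rule runs_mono[OF runs_Skip]) auto
    qed
  qed (use Suc.prems in auto)
  then show ?case by (rule runs_mono) auto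
qed

definition threshold :: "string \<Rightarrow> nat \<Rightarrow> prog" where
  "threshold w k = For w 2 (Seq (pick_heavy w k) (move_light w k))"

text \<open>The chosen heavy strategy is overwritten in each round. The invariant only asserts that
  each finished row has one, and the axiom of choice assembles them into the function
  \<open>g\<close>.\<close>

lemma runs_threshold:
  fixes s :: "nat \<Rightarrow> nat pmf"
  assumes w: "w \<noteq> ''s''" and N: "ints \<sigma> w [1] = N" and \<tau>: "reals \<sigma> w [0] = \<tau>" "\<tau> \<le> 1 / real k"
    and k: "k \<ge> 1" and s: "\<And>i. i < N \<Longrightarrow> set_pmf (s i) \<subseteq> {..<k}"
    and out: "\<And>i a. i < N \<Longrightarrow> a < k \<Longrightarrow> reals \<sigma> ''s'' [i, a] = pmf (s i) a"
  shows "runs (threshold w k) \<sigma> (N * (5 * k + 4) + 2)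
    (\<lambda>\<sigma>'. \<exists>g. \<forall>i<N. g i < k \<and> \<tau> \<le> pmf (s i) (g i) \<and> (\<forall>a<k. reals \<sigma>' ''s'' [i, a] =
       pmf (map_pmf (\<lambda>a. if pmf (s i) a < \<tau> then g i else a) (s i)) a))"
proof -
  let ?done = "\<lambda>i g (\<sigma>' :: state). g < k \<and> \<tau> \<le> pmf (s i) g \<and> (\<forall>a<k. reals \<sigma>' ''s'' [i, a] =
       pmf (map_pmf (\<lambda>a. if pmf (s i) a < \<tau> then g else a) (s i)) a)"
  let ?I = "\<lambda>i (\<sigma>' :: state). ints \<sigma>' w [1] = N \<and> reals \<sigma>' w [0] = \<tau> \<and>
    (\<forall>j<i. \<exists>g. ?done j g \<sigma>') \<and> (\<forall>j. i \<le> j \<longrightarrow> j < N \<longrightarrow> (\<forall>a<k. reals \<sigma>' ''s'' [j, a] = pmf (s j) a))"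
  have "runs (For w 2 (Seq (pick_heavy w k) (move_light w k))) \<sigma>
      (N * (((2 * k + 1) + (3 * k + 1)) + 2) + 2) (?I N)"
  proof (rule runs_For[where I = ?I])
    fix i and \<sigma>1 :: state assume i: "i < N" and I: "?I i \<sigma>1" and c: "ints \<sigma>1 w [2] = i"
    let ?p = "pmf (s i)"
    have row: "reals \<sigma>1 ''s'' [ints \<sigma>1 w [2], a] = ?p a" if "a < k" for a using I c i that by simp
    have ex: "\<exists>a<k. \<tau> \<le> ?p a" using ex_pmf_ge[OF s[OF i] k \<tau>(2)] .
    show "runs (Seq (pick_heavy w k) (move_light w k)) \<sigma>1 ((2 * k + 1) + (3 * k + 1))
        (\<lambda>\<sigma>'. ints \<sigma>' w [2] = i \<and> ?I (Suc i) (set_int w [2] (Suc i) \<sigma>'))"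
    proof (rule runs_Seq[OF runs_pick_heavy[OF row]])
      fix \<sigma>2 :: state assume "\<sigma>2 = \<sigma>1 \<and> (\<forall>a<k. ?p a < \<tau>) \<or> (\<exists>g<k. \<tau> \<le> ?p g \<and> \<sigma>2 = set_int w [3] g \<sigma>1)"
      then obtain g where g: "g < k" "\<tau> \<le> ?p g" "\<sigma>2 = set_int w [3] g \<sigma>1"
        using ex by (auto simp: not_less[symmetric])
      have *: "moved ?p \<tau> g k a = pmf (map_pmf (\<lambda>a. if ?p a < \<tau> then g else a) (s i)) a"
        if "a < k" for a
        using that unfolding pmf_map_threshold[OF s[OF i] g(2)] by (simp add: moved_def)
      have "runs (move_light w k) \<sigma>2 (3 * k + 1) (\<lambda>\<sigma>'. ints \<sigma>' = ints \<sigma>2 \<and> reals \<sigma>' w = reals \<sigma>2 w \<and>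
         (\<forall>a<k. reals \<sigma>' ''s'' [ints \<sigma>2 w [2], a] = moved ?p \<tau> g k a) \<and>
         (\<forall>i a. i \<noteq> ints \<sigma>2 w [2] \<longrightarrow> reals \<sigma>' ''s'' [i, a] = reals \<sigma>2 ''s'' [i, a]))"
        by (rule runs_move_light[where k = k]) (use w g I row in auto)
      then show "runs (move_light w k) \<sigma>2 (3 * k + 1)
          (\<lambda>\<sigma>'. ints \<sigma>' w [2] = i \<and> ?I (Suc i) (set_int w [2] (Suc i) \<sigma>'))"
      proof (rule runs_mono)
        fix \<sigma>3 :: state assume 3: "ints \<sigma>3 = ints \<sigma>2 \<and> reals \<sigma>3 w = reals \<sigma>2 w \<and>
         (\<forall>a<k. reals \<sigma>3 ''s'' [ints \<sigma>2 w [2], a] = moved ?p \<tau> g k a) \<and>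
         (\<forall>i a. i \<noteq> ints \<sigma>2 w [2] \<longrightarrow> reals \<sigma>3 ''s'' [i, a] = reals \<sigma>2 ''s'' [i, a])"
        have "ints \<sigma>2 w [2] = i" using g(3) c by simp
        then have row3: "\<forall>a<k. reals \<sigma>3 ''s'' [i, a] = moved ?p \<tau> g k a"
          and other: "\<forall>j a. j \<noteq> i \<longrightarrow> reals \<sigma>3 ''s'' [j, a] = reals \<sigma>1 ''s'' [j, a]"
          using 3 g(3) by simp_all
        have "\<exists>g. ?done j g \<sigma>3" if "j < Suc i" for j
        proof (cases "j = i")
          case True
          then show ?thesis using g row3 * by auto
        next
          case False
          then have "j < i" using that by simp
          then obtain h where "?done j h \<sigma>1" using I by blast
          then show ?thesis using other False by auto
        qed
        moreover have "\<forall>a<k. reals \<sigma>3 ''s'' [j, a] = pmf (s j) a" if "Suc i \<le> j" "j < N" for j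
          using I other that by simp
        ultimately show "ints \<sigma>3 w [2] = i \<and> ?I (Suc i) (set_int w [2] (Suc i) \<sigma>3)"
          using 3 g(3) I c by simp
      qed simp
    qed (use I in auto)
  qed (use N \<tau> out in auto)
  then have "runs (threshold w k) \<sigma> (N * (5 * k + 4) + 2) (?I N)"
    unfolding threshold_def by (rule runs_mono) (auto simp: algebra_simps)
  then show ?thesis by (rule runs_mono) (auto intro!: choice dest: spec)
qed

section \<open>Computing the number of players of the padded game\<close>

primrec RPow :: "rexp \<Rightarrow> nat \<Rightarrow> rexp" where
  "RPow e 0 = RConst 1"
| "RPow e (Suc m) = RMul e (RPow e m)"

lemma rval_RPow [simp]: "rval \<sigma> (RPow e m) = rval \<sigma> e ^ m"
  by (induction m) auto

text \<open>The power \<open>m\<close> makes up for \<open>c\<close> being close to 1, and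
  \<open>n + b\<close> pushes the size past the thresholds for which the estimates hold. With
  \<open>1 + 1 / \<epsilon>\<close> in place of \<open>1 / \<epsilon>\<close> the base stays large
  for large \<open>\<epsilon>\<close> as well.\<close>

definition padded_bound :: "nat \<Rightarrow> nat \<Rightarrow> nat \<Rightarrow> nat \<Rightarrow> real \<Rightarrow> real" where
  "padded_bound K m b n \<epsilon> = (real K * real n * ((1 + 1 / \<epsilon>) * (1 + 1 / \<epsilon>))) ^ m + real (n + b)"

definition padded_bound_exp :: "nat \<Rightarrow> nat \<Rightarrow> nat \<Rightarrow> rexp" where
  "padded_bound_exp K m b =
     (let q = RAdd (RConst 1) (RDiv (RConst 1) (RRef ''eps'' [])) in
      RAdd (RPow (RMul (RMul (RConst (of_nat K)) (ROfNat (IRef ''n'' []))) (RMul q q)) m)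
        (ROfNat (IAdd (IRef ''n'' []) (IConst b))))"

text \<open>The machine cannot round, so this ceiling is found by counting upwards, in time linear
  in the result.\<close>

definition padded_size :: "nat \<Rightarrow> nat \<Rightarrow> nat \<Rightarrow> nat \<Rightarrow> real \<Rightarrow> nat" where
  "padded_size K m b n \<epsilon> = nat \<lceil>padded_bound K m b n \<epsilon>\<rceil>"

text \<open>Using \<open>\<epsilon> / (1 + \<epsilon>)\<close>, which is below both 1 and
  \<open>\<epsilon>\<close>, keeps the cutoff below \<open>1 / k\<close> for every
  \<open>\<epsilon>\<close>, so that a heavy strategy exists.\<close>

definition cutoff :: "nat \<Rightarrow> nat \<Rightarrow> real \<Rightarrow> real" where
  "cutoff k n \<epsilon> = \<epsilon> / (1 + \<epsilon>) / (real (6 * k) * real n)"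

definition cutoff_exp :: "nat \<Rightarrow> rexp" where
  "cutoff_exp k = RDiv (RDiv (RRef ''eps'' []) (RAdd (RConst 1) (RRef ''eps'' [])))
     (RMul (RConst (of_nat (6 * k))) (ROfNat (IRef ''n'' [])))"

text \<open>Overwriting \<open>n\<close> and resetting \<open>eps\<close> makes the state look,
  outside \<open>w\<close> and the payoff table, like the plain input of the padded game.\<close>

definition prepare :: "string \<Rightarrow> nat \<Rightarrow> nat \<Rightarrow> nat \<Rightarrow> nat \<Rightarrow> prog" where
  "prepare w k K m b =
     Seq (IAssign w [IConst 0] (IRef ''n'' []))
    (Seq (IAssign w [IConst 1] (IConst 0))
    (Seq (Loop (RLess (ROfNat (cell w 1)) (padded_bound_exp K m b))
            (IAssign w [IConst 1] (IAdd (cell w 1) (IConst 1))))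
    (Seq (RAssign w [IConst 0] (cutoff_exp k))
    (Seq (IAssign ''n'' [] (cell w 1))
         (RAssign ''eps'' [] (RConst 0))))))"

lemma runs_Seq_det:
  "runs P \<sigma> T (\<lambda>\<sigma>'. \<sigma>' = \<rho>) \<Longrightarrow> runs P' \<rho> T' Q \<Longrightarrow> runs (Seq P P') \<sigma> (T + T') Q"
  by (erule runs_Seq) simp

lemma runs_prepare:
  assumes w: "w \<notin> {''n'', ''u'', ''eps''}" and \<epsilon>: "\<epsilon> > 0"
  shows "runs (prepare w k K m b) (set_real ''eps'' [] \<epsilon> (game_input n k u))
    (2 * padded_size K m b n \<epsilon> + 6)
    (table_state w (padded_size K m b n \<epsilon>) n (cutoff k n \<epsilon>) (payoff_table n k u))"
proof -
  define N where "N = padded_size K m b n \<epsilon>"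
  define R where "R = padded_bound K m b n \<epsilon>"
  define \<sigma>0 where "\<sigma>0 = set_real ''eps'' [] \<epsilon> (game_input n k u)"
  have N: "N = nat \<lceil>R\<rceil>" by (simp add: N_def R_def padded_size_def)
  have n: "ints \<sigma>0 ''n'' [] = n" and eps: "reals \<sigma>0 ''eps'' [] = \<epsilon>"
    by (simp_all add: \<sigma>0_def ints_game_input)
  let ?\<sigma> = "\<lambda>i. set_int w [1] i (set_int w [0] n \<sigma>0)"
  let ?\<sigma>1 = "set_real w [0] (cutoff k n \<epsilon>) (?\<sigma> N)"
  let ?\<sigma>2 = "set_int ''n'' [] N ?\<sigma>1"
  have b: "bval (?\<sigma> i) (RLess (ROfNat (cell w 1)) (padded_bound_exp K m b)) \<longleftrightarrow> real i < R" for i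
    using w n eps by (auto simp: padded_bound_exp_def Let_def R_def padded_bound_def)
  have loop: "runs (Loop (RLess (ROfNat (cell w 1)) (padded_bound_exp K m b))
      (IAssign w [IConst 1] (IAdd (cell w 1) (IConst 1)))) (?\<sigma> 0) ((N - 0) * (Suc 0 + 1) + 1)
      (\<lambda>\<sigma>. \<sigma> = ?\<sigma> N)"
  proof (rule runs_Loop[where I = "\<lambda>i \<sigma>. \<sigma> = ?\<sigma> i"])
    fix \<sigma> i assume i: "i < N" and \<sigma>: "\<sigma> = ?\<sigma> i"
    \<comment> \<open>For a natural number \<open>i\<close>, being below the ceiling of
      \<open>R\<close> is the same as being below \<open>R\<close>, so the loop makes exactly
      \<open>N\<close> rounds.\<close>
    from i have "real i < R" unfolding N by linarith
    then show "bval \<sigma> (RLess (ROfNat (cell w 1)) (padded_bound_exp K m b)) \<and>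
        runs (IAssign w [IConst 1] (IAdd (cell w 1) (IConst 1))) \<sigma> (Suc 0) (\<lambda>\<sigma>. \<sigma> = ?\<sigma> (Suc i))"
      unfolding \<sigma> using b by (auto intro!: runs_IAssign)
  next
    fix \<sigma> assume \<sigma>: "\<sigma> = ?\<sigma> N"
    have "\<not> real N < R" unfolding N by linarith
    then show "\<not> bval \<sigma> (RLess (ROfNat (cell w 1)) (padded_bound_exp K m b))"
      unfolding \<sigma> using b by blast
  qed auto
  have s1: "runs (IAssign w [IConst 0] (IRef ''n'' [])) \<sigma>0 (Suc 0) (\<lambda>\<sigma>. \<sigma> = set_int w [0] n \<sigma>0)"
    using n by (intro runs_IAssign) simp
  have s2: "runs (IAssign w [IConst 1] (IConst 0)) (set_int w [0] n \<sigma>0) (Suc 0) (\<lambda>\<sigma>. \<sigma> = ?\<sigma> 0)"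
    by (intro runs_IAssign) simp
  have s4: "runs (RAssign w [IConst 0] (cutoff_exp k)) (?\<sigma> N) (Suc 0) (\<lambda>\<sigma>. \<sigma> = ?\<sigma>1)"
    using w n eps by (intro runs_RAssign) (auto simp: cutoff_exp_def cutoff_def of_rat_mult)
  have s5: "runs (IAssign ''n'' [] (cell w 1)) ?\<sigma>1 (Suc 0) (\<lambda>\<sigma>. \<sigma> = ?\<sigma>2)"
    by (intro runs_IAssign) simp
  have s6: "runs (RAssign ''eps'' [] (RConst 0)) ?\<sigma>2 (Suc 0) (\<lambda>\<sigma>. \<sigma> = set_real ''eps'' [] 0 ?\<sigma>2)"
    by (intro runs_RAssign) simp
  have "runs (prepare w k K m b) \<sigma>0
      (Suc 0 + (Suc 0 + (((N - 0) * (Suc 0 + 1) + 1) + (Suc 0 + (Suc 0 + Suc 0)))))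
      (\<lambda>\<sigma>. \<sigma> = set_real ''eps'' [] 0 ?\<sigma>2)"
    unfolding prepare_def
    by (rule runs_Seq_det[OF s1 runs_Seq_det[OF s2 runs_Seq_det[OF loop
        runs_Seq_det[OF s4 runs_Seq_det[OF s5 s6]]]]])
  then show ?thesis
    unfolding N_def[symmetric] \<sigma>0_def[symmetric]
    by (rule runs_mono) (use w in \<open>auto simp: table_state_def \<sigma>0_def ints_game_input
        reals_game_input fun_eq_iff\<close>)
qed

section \<open>The choice of the constants\<close>

text \<open>From \<open>N \<ge> B ^ m\<close> and \<open>m * (c - 1) \<ge> 1\<close> follows
  \<open>N powr (c - 1) \<ge> B\<close>, hence
  \<open>N * \<eta> \<le> C / B \<le> e\<^sup>2 / (18 * D)\<close>. With the cutoff
  \<open>e / (6 * D)\<close> the three error terms are at most \<open>e / 3\<close>,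
  \<open>e / 9\<close> and \<open>e / 3\<close>, which sum to less than
  \<open>e \<le> \<epsilon>\<close>.\<close>

lemma padding_estimate:
  fixes C c \<eta> \<epsilon> :: real
  assumes c: "c > 1" and C: "C \<ge> 0" and K: "18 * C * real k \<le> real K" "1 \<le> K"
    and m: "1 \<le> real m * (c - 1)" and kn: "1 \<le> k" "1 \<le> n" and \<epsilon>: "\<epsilon> > 0"
    and N: "padded_bound K m b n \<epsilon> \<le> real N" and \<eta>: "0 \<le> \<eta>" "\<eta> \<le> C * real N powr (- c)"
  shows "\<eta> / cutoff k n \<epsilon> + 2 * (real (N - n) * \<eta> + real n * (real k * cutoff k n \<epsilon>)) \<le> \<epsilon>"
proof -
  define e where "e = \<epsilon> / (1 + \<epsilon>)"
  define D where "D = real k * real n"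
  define B where "B = real K * real n * ((1 + 1 / \<epsilon>) * (1 + 1 / \<epsilon>))"
  have e: "0 < e" "e < 1" "e \<le> \<epsilon>" and inv: "1 + 1 / \<epsilon> = 1 / e"
    using \<epsilon> by (auto simp: e_def field_simps)
  have D: "1 \<le> D" using kn mult_mono[of 1 "real k" 1 "real n"] by (simp add: D_def)
  have B: "B = real K * real n / e\<^sup>2" unfolding B_def inv by (simp add: power2_eq_square)
  have "1 \<le> real K * real n" using K(2) kn mult_mono[of 1 "real K" 1 "real n"] by simp
  moreover have "e\<^sup>2 \<le> 1" using e by (simp add: power_le_one)
  ultimately have B1: "1 \<le> B" using e by (simp add: B field_simps)
  have "18 * C * real k * real n \<le> real K * real n" using K(1) by (intro mult_right_mono) auto
  then have BC: "C / B \<le> e\<^sup>2 / (18 * D)"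
    using e D B1 K(2) kn by (simp add: B D_def field_simps)
  have "B ^ m \<le> real N" using N by (simp add: padded_bound_def B_def)
  moreover have "1 \<le> B ^ m" using B1 by (rule one_le_power)
  ultimately have N1: "1 \<le> real N" by linarith
  have "B = B powr 1" using B1 by simp
  also have "\<dots> \<le> B powr (real m * (c - 1))" using B1 m by (intro powr_mono) auto
  also have "\<dots> = (B ^ m) powr (c - 1)" using B1 by (simp add: powr_powr powr_realpow[symmetric])
  also have "\<dots> \<le> real N powr (c - 1)" using \<open>B ^ m \<le> real N\<close> B1 c by (intro powr_mono2) auto
  finally have BN: "B \<le> real N powr (c - 1)" .
  have "real N * \<eta> \<le> real N * (C * real N powr (- c))" using \<eta> by (intro mult_left_mono) auto
  also have "\<dots> = C * (real N powr 1 * real N powr (- c))" using N1 by simp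
  also have "\<dots> = C / real N powr (c - 1)"
    unfolding powr_add[symmetric] using powr_minus_divide[of "real N" "c - 1"] by simp
  also have "\<dots> \<le> C / B" using C BN B1 N1 by (intro divide_left_mono mult_pos_pos) auto
  also note BC
  finally have N\<eta>: "real N * \<eta> \<le> e\<^sup>2 / (18 * D)" .
  have "\<eta> \<le> real N * \<eta>" using mult_right_mono[of 1 "real N" \<eta>] N1 \<eta> by simp
  with N\<eta> have \<eta>D: "\<eta> \<le> e\<^sup>2 / (18 * D)" by linarith
  have \<tau>: "cutoff k n \<epsilon> = e / (6 * D)" by (simp add: cutoff_def e_def D_def mult.assoc)
  have "\<eta> / cutoff k n \<epsilon> \<le> e\<^sup>2 / (18 * D) / (e / (6 * D))"
    unfolding \<tau> using \<eta>D e D by (intro divide_right_mono) auto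
  also have "\<dots> = e / 3" using e D by (simp add: power2_eq_square)
  finally have 1: "\<eta> / cutoff k n \<epsilon> \<le> e / 3" .
  have "real (N - n) * \<eta> \<le> real N * \<eta>" using \<eta> by (intro mult_right_mono) auto
  also note N\<eta>
  also have "e\<^sup>2 / (18 * D) \<le> e / 18"
    using e D by (simp add: power2_eq_square frac_le mult_le_cancel_left2 field_simps mult_mono)
  finally have 2: "real (N - n) * \<eta> \<le> e / 18" .
  have "real n * (real k * cutoff k n \<epsilon>) = D * (e / (6 * D))" unfolding \<tau> by (simp add: D_def)
  also have "\<dots> = e / 6" using D by simp
  finally show ?thesis using 1 2 e by (simp add: field_simps)
qed

lemma cutoff_bounds:
  assumes "\<epsilon> > 0" "1 \<le> k" "1 \<le> n"
  shows "0 < cutoff k n \<epsilon>" "cutoff k n \<epsilon> \<le> 1 / real k"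
proof -
  show "0 < cutoff k n \<epsilon>" using assms by (simp add: cutoff_def)
  have "cutoff k n \<epsilon> \<le> 1 / (real (6 * k) * real n)"
    unfolding cutoff_def using assms by (intro divide_right_mono) (auto simp: field_simps)
  also have "\<dots> \<le> 1 / real k"
    using assms mult_mono[of 1 "real n" "real k" "real (6 * k)"]
    by (intro divide_left_mono) (auto simp: mult.commute)
  finally show "cutoff k n \<epsilon> \<le> 1 / real k" .
qed

section \<open>The running time\<close>

lemma nest_time_poly: "\<exists>q :: nat poly. \<forall>N. nest_time N T j = poly q N"
proof (induction j)
  case 0
  show ?case by (rule exI[of _ "[:T:]"]) simp
next
  case (Suc j)
  then obtain q :: "nat poly" where "\<forall>N. nest_time N T j = poly q N" by blast
  then show ?case by (intro exI[of _ "[:0, 1:] * (q + [:2:]) + [:2:]"]) simp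
qed

text \<open>Coefficients that are natural numbers are nonnegative, which makes the polynomial
  monotone.\<close>

lemma poly_of_nat_le:
  fixes q :: "nat poly"
  assumes "real N \<le> B"
  shows "real (poly q N) \<le> poly (map_poly real q) B"
proof (induction q)
  case (pCons a q)
  have "real N * real (poly q N) \<le> B * poly (map_poly real q) B"
    using assms pCons(2) by (intro mult_mono) auto
  then show ?case using pCons(1) by (simp add: map_poly_pCons)
qed simp

text \<open>Closure under the ring operations produces the required \<open>real poly poly\<close>
  from a formula, without computing coefficients.\<close>

definition bivariate_poly :: "(real \<Rightarrow> real \<Rightarrow> real) \<Rightarrow> bool" where
  "bivariate_poly f \<longleftrightarrow> (\<exists>p :: real poly poly. \<forall>x y. f x y = poly (poly p [:x:]) y)"

lemma bivariate_poly_const: "bivariate_poly (\<lambda>x y. c)"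
  unfolding bivariate_poly_def by (rule exI[of _ "[:[:c:]:]"]) simp

lemma bivariate_poly_fst: "bivariate_poly (\<lambda>x y. x)"
  unfolding bivariate_poly_def by (rule exI[of _ "[:0, 1:]"]) simp

lemma bivariate_poly_snd: "bivariate_poly (\<lambda>x y. y)"
  unfolding bivariate_poly_def by (rule exI[of _ "[:[:0, 1:]:]"]) simp

lemma bivariate_poly_add:
  assumes "bivariate_poly f" "bivariate_poly g"
  shows "bivariate_poly (\<lambda>x y. f x y + g x y)"
proof -
  from assms obtain p q where "\<forall>x y. f x y = poly (poly p [:x:]) y" "\<forall>x y. g x y = poly (poly q [:x:]) y"
    unfolding bivariate_poly_def by blast
  then show ?thesis unfolding bivariate_poly_def by (intro exI[of _ "p + q"]) simp
qed

lemma bivariate_poly_mult: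
  assumes "bivariate_poly f" "bivariate_poly g"
  shows "bivariate_poly (\<lambda>x y. f x y * g x y)"
proof -
  from assms obtain p q where "\<forall>x y. f x y = poly (poly p [:x:]) y" "\<forall>x y. g x y = poly (poly q [:x:]) y"
    unfolding bivariate_poly_def by blast
  then show ?thesis unfolding bivariate_poly_def by (intro exI[of _ "p * q"]) simp
qed

lemma bivariate_poly_power: "bivariate_poly f \<Longrightarrow> bivariate_poly (\<lambda>x y. f x y ^ m)"
  by (induction m) (simp_all add: bivariate_poly_const bivariate_poly_mult)

lemma bivariate_poly_poly: "bivariate_poly f \<Longrightarrow> bivariate_poly (\<lambda>x y. poly q (f x y))"
  by (induction q) (simp_all add: bivariate_poly_const bivariate_poly_mult bivariate_poly_add)

section \<open>The approximation scheme\<close>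

definition scheme :: "string \<Rightarrow> nat \<Rightarrow> nat \<Rightarrow> nat \<Rightarrow> nat \<Rightarrow> prog \<Rightarrow> prog" where
  "scheme w k K m b P =
     Seq (prepare w k K m b)
    (Seq (Seq (Nest w (k + 2) (fill_cell w k)) (Nest w (k + 2) (clear_cell w k)))
    (Seq P (threshold w k)))"

definition scheme_time :: "nat \<Rightarrow> nat poly \<Rightarrow> nat \<Rightarrow> nat" where
  "scheme_time k p N = (2 * N + 6) + ((nest_time N 4 (k + 2) + nest_time N 2 (k + 2)) +
     (poly p N + (N * (5 * k + 4) + 2)))"

lemma scheme_time_poly: "\<exists>q :: nat poly. \<forall>N. scheme_time k p N = poly q N"
proof -
  obtain q1 q2 :: "nat poly" where "\<forall>N. nest_time N 4 (k + 2) = poly q1 N"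
    "\<forall>N. nest_time N 2 (k + 2) = poly q2 N"
    using nest_time_poly by meson
  then show ?thesis
    by (intro exI[of _ "[:6, 2:] + ((q1 + q2) + (p + [:2, 5 * k + 4:]))"])
      (simp only: scheme_time_def, simp add: algebra_simps)
qed

lemma scheme_time_bivariate:
  "\<exists>pp :: real poly poly. \<forall>n \<epsilon>. \<epsilon> > 0 \<longrightarrow>
    real (scheme_time k p (padded_size K m b n \<epsilon>)) \<le> poly (poly pp [:real n:]) (1 / \<epsilon>)"
proof -
  obtain q :: "nat poly" where q: "\<And>N. scheme_time k p N = poly q N"
    using scheme_time_poly by blast
  \<comment> \<open>The final \<open>1\<close> pays for rounding up to
    \<open>padded_size\<close>.\<close>
  let ?B = "\<lambda>x y :: real. (real K * x * ((1 + y) * (1 + y))) ^ m + (x + real b) + 1"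
  have "bivariate_poly (\<lambda>x y. poly (map_poly real q) (?B x y))"
    by (intro bivariate_poly_poly bivariate_poly_add bivariate_poly_power bivariate_poly_mult
        bivariate_poly_const bivariate_poly_fst bivariate_poly_snd)
  then obtain pp where pp: "\<And>x y. poly (map_poly real q) (?B x y) = poly (poly pp [:x:]) y"
    unfolding bivariate_poly_def by blast
  have size: "real (padded_size K m b n \<epsilon>) \<le> ?B (real n) (1 / \<epsilon>)" if "\<epsilon> > 0" for n \<epsilon>
  proof -
    have "0 \<le> padded_bound K m b n \<epsilon>" using that by (simp add: padded_bound_def)
    then have "real (padded_size K m b n \<epsilon>) \<le> padded_bound K m b n \<epsilon> + 1"
      unfolding padded_size_def by linarith
    then show ?thesis by (simp add: padded_bound_def)
  qed
  show ?thesis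
  proof (intro exI allI impI)
    fix n and \<epsilon> :: real assume "\<epsilon> > 0"
    from poly_of_nat_le[OF size[OF this], of q]
    show "real (scheme_time k p (padded_size K m b n \<epsilon>)) \<le> poly (poly pp [:real n:]) (1 / \<epsilon>)"
      by (simp only: q pp)
  qed
qed

lemma runs_scheme:
  fixes N :: nat
  assumes w: "w \<notin> {''n'', ''u'', ''eps'', ''s''}" "w \<notin> prog_vars P"
    and N: "N = padded_size K m b n \<epsilon>" and \<epsilon>: "\<epsilon> > 0" and n: "1 \<le> n" "n < N" and k: "1 \<le> k" "k \<le> N"
    and P: "exec P (game_input N k (padded_game n N u)) t \<sigma>" "t \<le> poly p N"
    and s: "outputs_profile N k \<sigma> s" "mixed_profile N k s"
  shows "runs (scheme w k K m b P) (set_real ''eps'' [] \<epsilon> (game_input n k u)) (scheme_time k p N)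
    (\<lambda>\<sigma>'. \<exists>g. (\<forall>i<N. g i < k \<and> cutoff k n \<epsilon> \<le> pmf (s i) (g i)) \<and>
       outputs_profile N k \<sigma>' (\<lambda>i. map_pmf (\<lambda>a. if pmf (s i) a < cutoff k n \<epsilon> then g i else a) (s i)))"
  unfolding scheme_def scheme_time_def
proof (rule runs_Seq)
  let ?G = "game_input N k (padded_game n N u)"
  show "runs (prepare w k K m b) (set_real ''eps'' [] \<epsilon> (game_input n k u)) (2 * N + 6)
      (table_state w N n (cutoff k n \<epsilon>) (payoff_table n k u))"
    unfolding N using w(1) \<epsilon> by (intro runs_prepare) auto
  fix \<sigma>1 assume 1: "table_state w N n (cutoff k n \<epsilon>) (payoff_table n k u) \<sigma>1"
  show "runs (Seq (Seq (Nest w (k + 2) (fill_cell w k)) (Nest w (k + 2) (clear_cell w k)))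
      (Seq P (threshold w k))) \<sigma>1
      ((nest_time N 4 (k + 2) + nest_time N 2 (k + 2)) + (poly p N + (N * (5 * k + 4) + 2)))
      (\<lambda>\<sigma>'. \<exists>g. (\<forall>i<N. g i < k \<and> cutoff k n \<epsilon> \<le> pmf (s i) (g i)) \<and>
       outputs_profile N k \<sigma>' (\<lambda>i. map_pmf (\<lambda>a. if pmf (s i) a < cutoff k n \<epsilon> then g i else a) (s i)))"
  proof (rule runs_Seq[OF runs_build_padded[OF 1 _ n k]])
    fix \<sigma>2 assume 2: "table_state w N n (cutoff k n \<epsilon>) (payoff_table N k (padded_game n N u)) \<sigma>2"
    \<comment> \<open>Outside \<open>w\<close> the state is now exactly the input of the padded
      game, so the given run of \<open>P\<close> transfers, and the scratch data remain available
      for \<open>threshold\<close>.\<close>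
    then have "agree_off w ?G \<sigma>2"
      by (auto simp: agree_off_def table_state_def ints_game_input reals_game_input)
    from exec_agree_off[OF P(1) w(2) this] obtain \<sigma>3 where
      3: "exec P \<sigma>2 t \<sigma>3" "agree_off w \<sigma> \<sigma>3" "same_at w \<sigma>3 \<sigma>2" by blast
    show "runs (Seq P (threshold w k)) \<sigma>2 (poly p N + (N * (5 * k + 4) + 2))
      (\<lambda>\<sigma>'. \<exists>g. (\<forall>i<N. g i < k \<and> cutoff k n \<epsilon> \<le> pmf (s i) (g i)) \<and>
       outputs_profile N k \<sigma>' (\<lambda>i. map_pmf (\<lambda>a. if pmf (s i) a < cutoff k n \<epsilon> then g i else a) (s i)))"
    proof (rule runs_Seq_det)
      show "runs P \<sigma>2 (poly p N) (\<lambda>\<sigma>'. \<sigma>' = \<sigma>3)"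
        using 3 P(2) by (auto simp: runs_def)
      have "''s'' \<noteq> w" using w(1) by auto
      then have "reals \<sigma>3 ''s'' = reals \<sigma> ''s''" using 3(2) by (simp add: agree_off_def)
      then have out: "reals \<sigma>3 ''s'' [i, a] = pmf (s i) a" if "i < N" "a < k" for i a
        using s(1) that by (simp add: outputs_profile_def)
      have "runs (threshold w k) \<sigma>3 (N * (5 * k + 4) + 2) (\<lambda>\<sigma>'. \<exists>g. \<forall>i<N. g i < k \<and>
          cutoff k n \<epsilon> \<le> pmf (s i) (g i) \<and> (\<forall>a<k. reals \<sigma>' ''s'' [i, a] =
          pmf (map_pmf (\<lambda>a. if pmf (s i) a < cutoff k n \<epsilon> then g i else a) (s i)) a))"
      proof (rule runs_threshold)
        show "ints \<sigma>3 w [1] = N" "reals \<sigma>3 w [0] = cutoff k n \<epsilon>"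
          using 2 3(3) by (auto simp: table_state_def same_at_def)
        show "cutoff k n \<epsilon> \<le> 1 / real k" using cutoff_bounds \<epsilon> k n by blast
        show "set_pmf (s i) \<subseteq> {..<k}" if "i < N" for i
          using s(2) that by (simp add: mixed_profile_def)
      qed (use w k out in auto)
      then show "runs (threshold w k) \<sigma>3 (N * (5 * k + 4) + 2)
        (\<lambda>\<sigma>'. \<exists>g. (\<forall>i<N. g i < k \<and> cutoff k n \<epsilon> \<le> pmf (s i) (g i)) \<and>
         outputs_profile N k \<sigma>' (\<lambda>i. map_pmf (\<lambda>a. if pmf (s i) a < cutoff k n \<epsilon> then g i else a) (s i)))"
      proof (rule runs_mono)
        fix \<sigma>4 :: state
        assume "\<exists>g. \<forall>i<N. g i < k \<and> cutoff k n \<epsilon> \<le> pmf (s i) (g i) \<and>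
          (\<forall>a<k. reals \<sigma>4 ''s'' [i, a] =
          pmf (map_pmf (\<lambda>a. if pmf (s i) a < cutoff k n \<epsilon> then g i else a) (s i)) a)"
        then show "\<exists>g. (\<forall>i<N. g i < k \<and> cutoff k n \<epsilon> \<le> pmf (s i) (g i)) \<and>
         outputs_profile N k \<sigma>4 (\<lambda>i. map_pmf (\<lambda>a. if pmf (s i) a < cutoff k n \<epsilon> then g i else a) (s i))"
          unfolding outputs_profile_def by blast
      qed simp
    qed
  qed (use w in simp)
qed

lemma approx_NE_mono: "approx_NE n k u \<epsilon> s \<Longrightarrow> \<epsilon> \<le> \<epsilon>' \<Longrightarrow> approx_NE n k u \<epsilon>' s"
  unfolding approx_NE_def by (meson add_left_mono order_trans)

theorem theorem1p3:
  fixes k :: nat and c :: real and \<delta> :: "nat \<Rightarrow> real"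
  assumes "k \<ge> 1"
    and "c > 1"
    and "\<delta> \<in> O(\<lambda>n. real n powr (- c))"
    and "approx_NE_in_poly_time k \<delta>"
  shows "well_supported_NE_FPTAS k"
proof -
  from assms(4) obtain P and p :: "nat poly" where alg: "\<And>n u. anonymous_game n k u \<Longrightarrow>
      \<exists>t \<sigma> s. exec P (game_input n k u) t \<sigma> \<and> t \<le> poly p n \<and> outputs_profile n k \<sigma> s \<and>
        approx_NE n k u (\<delta> n) s"
    unfolding approx_NE_in_poly_time_def by blast
  from assms(3) obtain C where C: "C > 0"
    and "eventually (\<lambda>n. norm (\<delta> n) \<le> C * norm (real n powr (- c))) at_top"
    by (rule landau_o.bigE)
  then obtain n0 where \<delta>: "\<And>n. n \<ge> n0 \<Longrightarrow> \<bar>\<delta> n\<bar> \<le> C * real n powr (- c)"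
    unfolding eventually_sequentially by auto
  \<comment> \<open>\<open>K\<close> absorbs the constant \<open>C\<close> of the O-bound,
    \<open>m\<close> is chosen for \<open>m * (c - 1) \<ge> 1\<close>, and \<open>b\<close> puts
    \<open>N\<close> above \<open>n\<close>, \<open>k\<close> and the index \<open>n0\<close> from
    which the O-bound holds.\<close>
  define K where "K = nat \<lceil>18 * C * real k\<rceil> + 1"
  define m where "m = nat \<lceil>1 / (c - 1)\<rceil>"
  define b where "b = n0 + k + 1"
  have K: "18 * C * real k \<le> real K" "1 \<le> K" unfolding K_def by linarith+
  have "1 / (c - 1) \<le> real m" unfolding m_def by linarith
  then have m: "1 \<le> real m * (c - 1)" using assms(2) by (simp add: field_simps)
  have "finite (prog_vars P \<union> {''n'', ''u'', ''eps'', ''s''})" by (simp add: finite_prog_vars)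
  then obtain w where w: "w \<notin> {''n'', ''u'', ''eps'', ''s''}" "w \<notin> prog_vars P"
    using ex_new_if_finite[OF infinite_UNIV_listI] by (metis Un_iff)
  from scheme_time_bivariate[of k p K m b] obtain pp :: "real poly poly" where pp:
      "\<And>n \<epsilon>. \<epsilon> > 0 \<Longrightarrow>
      real (scheme_time k p (padded_size K m b n \<epsilon>)) \<le> poly (poly pp [:real n:]) (1 / \<epsilon>)"
    by auto
  show ?thesis
    unfolding well_supported_NE_FPTAS_def
  proof (rule exI[of _ "scheme w k K m b P"], rule exI[of _ pp], intro allI impI, elim conjE)
    fix n u and \<epsilon> :: real
    assume game: "anonymous_game n k u" and \<epsilon>: "\<epsilon> > 0"
    define N where "N = padded_size K m b n \<epsilon>"
    have n: "1 \<le> n" using game by (simp add: anonymous_game_def)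
    have bound: "padded_bound K m b n \<epsilon> \<le> real N" unfolding N_def padded_size_def by linarith
    moreover have "0 \<le> (real K * real n * ((1 + 1 / \<epsilon>) * (1 + 1 / \<epsilon>))) ^ m" using \<epsilon> by simp
    ultimately have "real (n + b) \<le> real N" unfolding padded_bound_def by linarith
    then have N: "n < N" "k \<le> N" "n0 \<le> N" unfolding b_def by linarith+
    obtain t \<sigma> s where P: "exec P (game_input N k (padded_game n N u)) t \<sigma>" "t \<le> poly p N"
      and s: "outputs_profile N k \<sigma> s" and NE: "approx_NE N k (padded_game n N u) (\<delta> N) s"
      using alg[OF anonymous_game_padded[OF game less_imp_le[OF N(1)]]] by blast
    have "mixed_profile N k s" using NE by (simp add: approx_NE_def)
    from runs_scheme[OF w N_def \<epsilon> n N(1) assms(1) N(2) P s this] obtain t' \<sigma>' g where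
      run: "exec (scheme w k K m b P) (set_real ''eps'' [] \<epsilon> (game_input n k u)) t' \<sigma>'"
        "t' \<le> scheme_time k p N"
      and g: "\<forall>i<N. g i < k \<and> cutoff k n \<epsilon> \<le> pmf (s i) (g i)"
      and out: "outputs_profile N k \<sigma>'
        (\<lambda>i. map_pmf (\<lambda>a. if pmf (s i) a < cutoff k n \<epsilon> then g i else a) (s i))"
      unfolding runs_def by blast
    \<comment> \<open>The assumption on \<open>\<delta>\<close> does not fix its sign; the absolute
      value weakens the equilibrium condition and supplies a nonnegative
      \<open>\<eta>\<close>.\<close>
    have abs: "approx_NE N k (padded_game n N u) \<bar>\<delta> N\<bar> s" using NE by (rule approx_NE_mono) simp
    have "well_supported_NE n k u \<epsilon>
        (\<lambda>i. map_pmf (\<lambda>a. if pmf (s i) a < cutoff k n \<epsilon> then g i else a) (s i))"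
    proof (rule well_supported_of_padded_approx_NE[OF game less_imp_le[OF N(1)] abs,
          where \<tau> = "cutoff k n \<epsilon>" and g = g])
      show "\<bar>\<delta> N\<bar> / cutoff k n \<epsilon> + 2 * (real (N - n) * \<bar>\<delta> N\<bar> + real n * (real k * cutoff k n \<epsilon>)) \<le> \<epsilon>"
        using assms(1,2) C K m n \<epsilon> bound \<delta>[OF N(3)] by (intro padding_estimate) auto
    qed (use N g \<epsilon> n assms(1) cutoff_bounds in auto)
    \<comment> \<open>Dropping the dummies takes no computation: the output is read from the first
      \<open>n\<close> rows only.\<close>
    moreover have "outputs_profile n k \<sigma>'
        (\<lambda>i. map_pmf (\<lambda>a. if pmf (s i) a < cutoff k n \<epsilon> then g i else a) (s i))"
      using out N(1) by (simp add: outputs_profile_def)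
    moreover have "real t' \<le> poly (poly pp [:real n:]) (1 / \<epsilon>)"
      using pp[OF \<epsilon>, of n] run(2) unfolding N_def by linarith
    ultimately show "\<exists>t \<sigma> s. exec (scheme w k K m b P) (set_real ''eps'' [] \<epsilon> (game_input n k u)) t \<sigma> \<and>
        real t \<le> poly (poly pp [:real n:]) (1 / \<epsilon>) \<and> outputs_profile n k \<sigma> s \<and>
        well_supported_NE n k u \<epsilon> s"
      using run(1) by blast
  qed
qed

end
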